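(* Let $C\in\mathbb{C}\setminus\{0\}$ and for $n\in\mathbb{N}$ let $$u_n(z)=\overline{C}\,\sqrt{\frac{n}{\pi}}\;\frac{\bar z^{\,n-1}}{|z|^{2n}+|C|^2},\qquad z\in\mathbb{C}.$$ Then $\int_{\mathbb{R}^2}|u_n|^2=1$ and $$\frac{\mathcal{E}_{\beta,2\pi\beta}[u_n]}{\int_{\mathbb{R}^2}|u_n|^4}=\frac{\pi(2n-1)}{n(n+1)}(\beta-2n)^2,\qquad\forall n\in\mathbb{N},\ \beta\ge0.$$ In particular, $$\gamma_*(\beta)\le2\pi+\frac{\pi}{2}\beta^2,\qquad\forall\beta\ge0.$$
   Context: $\mathbb{N}=\{1,2,\dots\}$, $\mathbb{R}^2\cong\mathbb{C}$ via $z=x_1+\mathrm{i}x_2$, $H^1=H^1(\mathbb{R}^2;\mathbb{C})$. For $\varrho\in L^1(\mathbb{R}^2)$ set $$\mathbf{A}[\varrho](\mathbf{x}):=\int_{\mathbb{R}^2}\frac{(\mathbf{x}-\mathbf{y})^\perp}{|\mathbf{x}-\mathbf{y}|^2}\varrho(\mathbf{y})\,\mathrm{d}\mathbf{y}$$ (principal value), $(x_1,x_2)^\perp=(-x_2,x_1)$. For $\beta,\gamma\in\mathbb{R}$ and $u\in H^1$, $$\mathcal{E}_{\beta}[u]:=\int_{\mathbb{R}^2}|(\nabla+\mathrm{i}\beta\mathbf{A}[|u|^2])u|^2,\qquad \mathcal{E}_{\beta,\gamma}[u]:=\mathcal{E}_\beta[u]-\gamma\int_{\mathbb{R}^2}|u|^4,$$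 $$\gamma_*(\beta):=\inf\left\{\frac{\mathcal{E}_\beta[u]}{\int_{\mathbb{R}^2}|u|^4}: u\in H^1,\ \int_{\mathbb{R}^2}|u|^2=1\right\}.$$ *)

theory Defs
  imports "HOL-Analysis.Analysis"
begin

text \<open>The plane is the type \<^typ>\<open>complex\<close>, with Lebesgue measure \<^const>\<open>lborel\<close>; its standard basis
  is \<^term>\<open>1::complex\<close>, \<^term>\<open>\<i>\<close>. Vectors in the plane, such as the values of the gauge potential,
  are complex numbers too, with Cartesian components given by \<^const>\<open>Re\<close> and \<^const>\<open>Im\<close>. Elements of
  \<open>L\<^sup>2\<close> and \<open>H\<^sup>1\<close> are represented by Borel functions rather than by a.e.-classes.\<close>

definition L2 :: "(complex \<Rightarrow> complex) set" where
  "L2 = {u \<in> borel_measurable lborel. integrable lborel (\<lambda>x. (cmod (u x))\<^sup>2)}"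

primrec C_k :: "nat \<Rightarrow> (complex \<Rightarrow> real) \<Rightarrow> bool" where
  "C_k 0 f \<longleftrightarrow> continuous_on UNIV f"
| "C_k (Suc k) f \<longleftrightarrow> f differentiable_on UNIV \<and>
     (\<forall>e\<in>Basis. C_k k (\<lambda>x. frechet_derivative f (at x) e))"

definition test_functions :: "(complex \<Rightarrow> real) set" where
  "test_functions = {\<phi>. (\<forall>k. C_k k \<phi>) \<and> compact (closure {x. \<phi> x \<noteq> 0})}"

text \<open>\<open>v\<close> is the weak partial derivative of \<open>u\<close> in direction \<open>e\<close>. This is only used for \<open>u\<close>, \<open>v\<close> in
  \<^const>\<open>L2\<close>, where both integrals converge. Real test functions suffice, by linearity.\<close>

definition is_weak_partial :: "complex \<Rightarrow> (complex \<Rightarrow> complex) \<Rightarrow> (complex \<Rightarrow> complex) \<Rightarrow> bool" where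
  "is_weak_partial e u v \<longleftrightarrow> (\<forall>\<phi>\<in>test_functions.
     (LINT x|lborel. frechet_derivative \<phi> (at x) e *\<^sub>R u x) = - (LINT x|lborel. \<phi> x *\<^sub>R v x))"

definition H1 :: "(complex \<Rightarrow> complex) set" where
  "H1 = {u \<in> L2. \<forall>e\<in>Basis. \<exists>v\<in>L2. is_weak_partial e u v}"

text \<open>The weak derivative is unique up to null sets, so the choice of representative is immaterial
  under integrals.\<close>

definition weak_partial :: "complex \<Rightarrow> (complex \<Rightarrow> complex) \<Rightarrow> complex \<Rightarrow> complex" where
  "weak_partial e u = (SOME v. v \<in> L2 \<and> is_weak_partial e u v)"

definition perp :: "complex \<Rightarrow> complex" where
  "perp x = Complex (- Im x) (Re x)"

text \<open>The principal value at the singularity; for integrable \<open>\<rho>\<close> each truncated integral converges.\<close>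

definition gauge_potential :: "(complex \<Rightarrow> real) \<Rightarrow> complex \<Rightarrow> complex" where
  "gauge_potential \<rho> x = Lim (at_right 0)
     (\<lambda>\<epsilon>. LINT y:{y. dist x y > \<epsilon>}|lborel. (\<rho> y / (norm (x - y))\<^sup>2) *\<^sub>R perp (x - y))"

text \<open>The two components of \<open>(\<nabla> + i\<beta>A[|u|\<^sup>2])u\<close>; the norm of \<^typ>\<open>complex \<times> complex\<close> is the
  Euclidean one.\<close>

definition covariant_gradient :: "real \<Rightarrow> (complex \<Rightarrow> complex) \<Rightarrow> complex \<Rightarrow> complex \<times> complex" where
  "covariant_gradient \<beta> u x =
     (let a = gauge_potential (\<lambda>y. (cmod (u y))\<^sup>2) x in
       (weak_partial 1 u x + \<i> * of_real (\<beta> * Re a) * u x,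
        weak_partial \<i> u x + \<i> * of_real (\<beta> * Im a) * u x))"

definition energy :: "real \<Rightarrow> (complex \<Rightarrow> complex) \<Rightarrow> real" where
  "energy \<beta> u = (LINT x|lborel. (norm (covariant_gradient \<beta> u x))\<^sup>2)"

definition quartic :: "(complex \<Rightarrow> complex) \<Rightarrow> real" where
  "quartic u = (LINT x|lborel. (cmod (u x)) ^ 4)"

definition energy_gamma :: "real \<Rightarrow> real \<Rightarrow> (complex \<Rightarrow> complex) \<Rightarrow> real" where
  "energy_gamma \<beta> \<gamma> u = energy \<beta> u - \<gamma> * quartic u"

text \<open>For \<open>u\<close> in \<^const>\<open>H1\<close> the integrals defining the two functionals are finite, and the quartic
  integral is positive for normalized \<open>u\<close>; the infimum is over a set of nonnegative reals.\<close>

definition gamma_star :: "real \<Rightarrow> real" where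
  "gamma_star \<beta> = Inf {energy \<beta> u / quartic u | u.
     u \<in> H1 \<and> (LINT x|lborel. (cmod (u x))\<^sup>2) = 1}"

definition soliton :: "complex \<Rightarrow> nat \<Rightarrow> complex \<Rightarrow> complex" where
  "soliton C n z = cnj C * of_real (sqrt (real n / pi)) *
     (cnj z ^ (n - 1) / of_real (cmod z ^ (2 * n) + (cmod C)\<^sup>2))"

end

theory Submission
  imports Defs "HOL-Complex_Analysis.Complex_Analysis"
begin

text \<open>
  Write \<open>K = |C|\<^sup>2\<close>, \<open>t = |z|\<^sup>2\<^sup>n\<close>. The density \<open>|u\<^sub>n|\<^sup>2\<close> is radial and its mass inside the disc of radius \<open>|z|\<close>
  is \<open>M = t / (t + K)\<close>, so Newton's theorem gives \<open>A = M z\<^bsup>\<bottom>\<^esup> / |z|\<^sup>2\<close>. Newton's theorem itself reduces, by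
  averaging over rotations, to a Cauchy integral: the mean of \<open>1 / (x - e\<^bsup>-i\<theta>\<^esup> y)\<close> over \<open>\<theta>\<close> is \<open>1 / x\<close> for
  \<open>|y| < |x|\<close> and \<open>0\<close> for \<open>|y| > |x|\<close>. The covariant gradient is then explicit, and energy and
  quartic integral are combinations of the moments \<open>\<integral> |z|\<^bsup>p\<^esup> / (t + K)\<^sup>4\<close> with
  \<open>p = 2n - 4, 4n - 4, 6n - 4\<close>. Integrating the radial derivative of \<open>r\<^bsup>k\<^esup> / (r\<^sup>2\<^sup>n + K)\<^sup>3\<close> relates
  consecutive ones, so every ratio is rational in \<open>n\<close> and \<open>\<beta>\<close>. The bound on \<open>\<gamma>\<^sub>*\<close> is the case \<open>n = 1\<close>.
\<close>

section \<open>Rotations and radial integrals\<close>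

text \<open>\<open>weak_partial\<close> is an arbitrary choice among the weak derivatives, so the
  energy can be computed only once that choice is known almost everywhere. This calls for uniqueness
  of weak derivatives, hence for enough test functions in the sense of \<open>C_k\<close>, and for
  integration by parts against them. The principal value is harmless: the density is bounded and
  integrable, so the singular kernel is absolutely integrable against it. The coupling
  \<open>2 * pi * \<beta>\<close> is the self-dual one: the curl of \<beta> A[\<rho>] is 2 pi
  \<beta> \<rho>. For the solitons it turns the energy into a multiple of a perfect square in
  \<beta> that vanishes at \<beta> = 2 n.\<close>

text \<open>Uniqueness of Haar measure, in this special case: with \<open>f\<close> the indicator of the unit disc,
  integrate \<open>f x * g (x + w * y)\<close> in both orders, using translation invariance and \<open>f (w * z) = f z\<close>.\<close>

lemma nn_integral_lborel_rotate:
  fixes w :: complex and g :: "complex \<Rightarrow> ennreal"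
  assumes w: "cmod w = 1" and g[measurable]: "g \<in> borel_measurable borel"
  shows "(\<integral>\<^sup>+y. g (w * y) \<partial>lborel) = (\<integral>\<^sup>+y. g y \<partial>lborel)"
proof -
  have w0: "w \<noteq> 0" using w by auto
  have shift: "(\<integral>\<^sup>+y. h (c + y) \<partial>lborel) = (\<integral>\<^sup>+y. h y \<partial>lborel)"
    if [measurable]: "h \<in> borel_measurable borel" for h :: "complex \<Rightarrow> ennreal" and c
    by (subst (2) lborel_distr_plus[of c, symmetric]) (simp add: nn_integral_distr)
  have flip: "(\<integral>\<^sup>+y. h (c - y) \<partial>lborel) = (\<integral>\<^sup>+y. h y \<partial>lborel)"
    if [measurable]: "h \<in> borel_measurable borel" for h :: "complex \<Rightarrow> ennreal" and c
    by (subst (2) lborel_affine[of "-1" c])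
       (simp_all add: nn_integral_distr density_1 nn_integral_density scaleR_conv_of_real)
  define f :: "complex \<Rightarrow> ennreal" where "f = indicator (cball 0 1)"
  have [measurable]: "f \<in> borel_measurable borel"
    unfolding f_def by (intro borel_measurable_indicator) simp
  have If: "(\<integral>\<^sup>+y. f y \<partial>lborel) = ennreal pi"
    by (simp add: f_def emeasure_cball unit_ball_vol_2)
  have rot: "f (x - w * y) = f (x / w - y)" for x y
  proof -
    have "x - w * y = w * (x / w - y)" using w0 by (simp add: field_simps)
    then show ?thesis by (simp add: f_def indicator_def norm_mult w)
  qed
  have rot2: "g (x + w * y) = g (w * (x / w + y))" for x y
    using w0 by (simp add: distrib_left)
  have "(\<integral>\<^sup>+y. g (w * y) \<partial>lborel) * ennreal pi
      = (\<integral>\<^sup>+x. \<integral>\<^sup>+y. f x * g (x + w * y) \<partial>lborel \<partial>lborel)"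
    using shift[of "\<lambda>y. g (w * y)"]
    by (simp add: nn_integral_cmult rot2 nn_integral_multc If) (simp add: mult.commute)
  also have "\<dots> = (\<integral>\<^sup>+y. \<integral>\<^sup>+x. f x * g (x + w * y) \<partial>lborel \<partial>lborel)"
    by (rule lborel_pair.Fubini') measurable
  also have "\<dots> = (\<integral>\<^sup>+y. \<integral>\<^sup>+x. f (x - w * y) * g x \<partial>lborel \<partial>lborel)"
  proof (rule nn_integral_cong)
    fix y :: complex
    show "(\<integral>\<^sup>+x. f x * g (x + w * y) \<partial>lborel) = (\<integral>\<^sup>+x. f (x - w * y) * g x \<partial>lborel)"
      using shift[of "\<lambda>x. f (x - w * y) * g x" "w * y"] by (simp add: add.commute)
  qed
  also have "\<dots> = (\<integral>\<^sup>+x. \<integral>\<^sup>+y. f (x - w * y) * g x \<partial>lborel \<partial>lborel)"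
    by (rule lborel_pair.Fubini') measurable
  also have "\<dots> = (\<integral>\<^sup>+x. g x \<partial>lborel) * ennreal pi"
    by (simp add: rot nn_integral_multc flip If nn_integral_cmult) (simp add: mult.commute)
  finally show ?thesis
    by (simp add: mult.commute[of _ "ennreal pi"] ennreal_mult_cancel_left)
qed

lemma lborel_distr_rotate:
  fixes w :: complex
  assumes "cmod w = 1"
  shows "distr lborel borel ((*) w) = lborel"
proof (rule measure_eqI)
  fix A :: "complex set"
  assume "A \<in> sets (distr lborel borel ((*) w))"
  then have [measurable]: "A \<in> sets borel" by simp
  have "emeasure (distr lborel borel ((*) w)) A = (\<integral>\<^sup>+y. indicator A y \<partial>distr lborel borel ((*) w))"
    by simp
  also have "\<dots> = (\<integral>\<^sup>+y. indicator A (w * y) \<partial>lborel)"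
    by (rule nn_integral_distr) auto
  also have "\<dots> = emeasure lborel A"
    by (subst nn_integral_lborel_rotate[OF assms]) auto
  finally show "emeasure (distr lborel borel ((*) w)) A = emeasure lborel A" .
qed simp

text \<open>Polar coordinates for radial functions: the half-lines \<open>{..a}\<close> are a
  generating system closed under intersection, their preimages are discs of area pi a^2, and 2 pi r
  is the derivative of that area.\<close>

lemma distr_lborel_cmod:
  "distr lborel borel cmod = density lborel (\<lambda>r. ennreal (2 * pi * r) * indicator {0..} r)"
proof (rule measure_eqI_generator_eq[where \<Omega> = UNIV and E = "range atMost" and A = "\<lambda>n::nat. {..real n}"])
  show "Int_stable (range atMost :: real set set)"
    by (auto simp: Int_stable_def)
  fix X :: "real set" assume "X \<in> range atMost"
  then obtain a where X: "X = {..a}" by auto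
  have "emeasure (distr lborel borel cmod) X = emeasure lborel (cball (0::complex) a)"
    by (simp add: emeasure_distr X vimage_def cball_def)
  also have "\<dots> = ennreal (if a \<ge> 0 then pi * a\<^sup>2 else 0)"
    by (simp add: emeasure_cball unit_ball_vol_2)
  also have "\<dots> = (\<integral>\<^sup>+r. ennreal (2 * pi * r) * indicator {0..a} r \<partial>lborel)"
  proof (cases "a \<ge> 0")
    case True
    have "(\<integral>\<^sup>+r. ennreal (2 * pi * r) * indicator {0..a} r \<partial>lborel) = ennreal (pi * a\<^sup>2 - pi * 0\<^sup>2)"
      by (rule nn_integral_FTC_Icc) (use True in \<open>auto intro!: derivative_eq_intros\<close>)
    then show ?thesis using True by simp
  qed auto
  also have "\<dots> = emeasure (density lborel (\<lambda>r. ennreal (2 * pi * r) * indicator {0..} r)) X"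
    by (auto simp: emeasure_density X indicator_def intro!: nn_integral_cong)
  finally show "emeasure (distr lborel borel cmod) X
    = emeasure (density lborel (\<lambda>r. ennreal (2 * pi * r) * indicator {0..} r)) X" .
next
  show "emeasure (distr lborel borel cmod) {..real n} \<noteq> \<infinity>" for n
    by (simp add: emeasure_distr vimage_def emeasure_cball flip: cball_def[of "0::complex", simplified])
next
  show "(\<Union>n. {..real n}) = UNIV"
    using real_arch_simple by auto
qed (auto simp: borel_eq_atMost)

lemma nn_integral_radial:
  assumes [measurable]: "f \<in> borel_measurable borel"
  shows "(\<integral>\<^sup>+z. f (cmod z) \<partial>lborel) = (\<integral>\<^sup>+r. ennreal (2 * pi * r) * f r * indicator {0..} r \<partial>lborel)"
proof -
  have "(\<integral>\<^sup>+z. f (cmod z) \<partial>lborel) = (\<integral>\<^sup>+r. f r \<partial>distr lborel borel cmod)"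
    by (rule nn_integral_distr[symmetric]) auto
  then show ?thesis
    by (simp add: distr_lborel_cmod nn_integral_density mult_ac)
qed

lemma integral_radial:
  fixes f :: "real \<Rightarrow> real"
  assumes [measurable]: "f \<in> borel_measurable borel"
  shows "(LINT z|lborel. f (cmod z)) = (LINT r|lborel. indicator {0..} r * (2 * pi * r * f r))"
    and "integrable lborel (\<lambda>z. f (cmod z)) \<longleftrightarrow> integrable lborel (\<lambda>r. indicator {0..} r * (2 * pi * r * f r))"
proof -
  have eq: "distr lborel borel cmod = density lborel (\<lambda>r. ennreal (indicator {0..} r * (2 * pi * r)))"
    unfolding distr_lborel_cmod by (intro arg_cong[where f = "density lborel"] ext) (auto simp: indicator_def)
  have "(LINT z|lborel. f (cmod z)) = (LINT r|distr lborel borel cmod. f r)"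
    by (rule integral_distr[symmetric]) auto
  also have "\<dots> = (LINT r|lborel. (indicator {0..} r * (2 * pi * r)) *\<^sub>R f r)"
    unfolding eq by (rule integral_density) (auto simp: indicator_def)
  finally show "(LINT z|lborel. f (cmod z)) = (LINT r|lborel. indicator {0..} r * (2 * pi * r * f r))"
    by (simp add: mult_ac)
  have "integrable lborel (\<lambda>z. f (cmod z)) \<longleftrightarrow> integrable (distr lborel borel cmod) f"
    by (rule integrable_distr_eq[symmetric]) auto
  also have "\<dots> \<longleftrightarrow> integrable lborel (\<lambda>r. (indicator {0..} r * (2 * pi * r)) *\<^sub>R f r)"
    unfolding eq by (rule integrable_density) (auto simp: indicator_def)
  finally show "integrable lborel (\<lambda>z. f (cmod z)) \<longleftrightarrow> integrable lborel (\<lambda>r. indicator {0..} r * (2 * pi * r * f r))"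
    by (simp add: mult_ac)
qed

text \<open>With u = e^(2 pi i t) the integrand becomes du / (2 pi i (u x - y)). Its only pole, y /
  x, lies inside the unit circle exactly when |y| < |x|.\<close>

lemma has_integral_circle_Cauchy_kernel:
  assumes "cmod x \<noteq> cmod y" "x \<noteq> 0"
  shows "((\<lambda>t. 1 / (x - cis (- 2 * pi * t) * y)) has_integral (if cmod y < cmod x then 1 / x else 0)) {0..1}"
proof -
  have "((\<lambda>u. 1 / (u * x - y)) has_contour_integral
      2 * pi * \<i> * (if cmod y < cmod x then 1 / x else 0)) (circlepath 0 1)"
  proof (cases "cmod y < cmod x")
    case True
    have "((\<lambda>u. (1 / x) / (u - y / x)) has_contour_integral 2 * pi * \<i> * (1 / x)) (circlepath 0 1)"
      using Cauchy_integral_circlepath_simple[of "\<lambda>_. 1 / x" 0 1 "y / x"] True assms(2)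
      by (simp add: norm_divide divide_less_eq)
    moreover have "(1 / x) / (u - y / x) = 1 / (u * x - y)" for u
      using assms(2) by (simp add: field_simps)
    ultimately show ?thesis using True by simp
  next
    case False
    then have lt: "cmod x < cmod y" using assms by simp
    have nz: "u * x \<noteq> y" if "cmod u \<le> 1" for u
    proof
      assume "u * x = y"
      then have "cmod y = cmod u * cmod x" by (auto simp: norm_mult)
      moreover have "cmod u * cmod x \<le> 1 * cmod x" by (intro mult_right_mono that) auto
      ultimately show False using lt by simp
    qed
    have "((\<lambda>u. 1 / (u * x - y)) has_contour_integral 0) (circlepath 0 1)"
    proof (rule Cauchy_theorem_convex_simple[where S = "cball 0 1"])
      show "(\<lambda>u. 1 / (u * x - y)) holomorphic_on cball 0 1"
        by (intro holomorphic_intros) (use nz in auto)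
    qed auto
    then show ?thesis using False by simp
  qed
  then have "((\<lambda>t. (2 * pi * \<i>) * (1 / (x - cis (- 2 * pi * t) * y))) has_integral
      (2 * pi * \<i>) * (if cmod y < cmod x then 1 / x else 0)) {0..1}"
    unfolding has_contour_integral_def
  proof (rule has_integral_eq[rotated])
    fix t :: real assume t: "t \<in> {0..1}"
    have e: "exp (2 * of_real pi * \<i> * of_real t) = cis (2 * pi * t)"
      by (simp add: cis_conv_exp algebra_simps)
    have nz: "cis (2 * pi * t) * x - y \<noteq> 0"
    proof
      assume "cis (2 * pi * t) * x - y = 0"
      then have "cmod y = cmod x" by (metis eq_iff_diff_eq_0 norm_cis norm_mult mult_1)
      then show False using assms by simp
    qed
    have "x - cis (- 2 * pi * t) * y = cis (- (2 * pi * t)) * (cis (2 * pi * t) * x - y)"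
      by (simp add: algebra_simps cis_mult flip: mult.assoc)
    moreover have "cis (- (2 * pi * t)) = inverse (cis (2 * pi * t))" by (simp add: cis_inverse)
    moreover have "vector_derivative (circlepath 0 1) (at t within {0..1}) = 2 * pi * \<i> * cis (2 * pi * t)"
      using t by (simp add: vector_derivative_circlepath01 e)
    moreover have "circlepath 0 1 t = cis (2 * pi * t)"
      by (simp add: circlepath e)
    ultimately show "1 / (circlepath 0 1 t * x - y) * vector_derivative (circlepath 0 1) (at t within {0..1})
      = 2 * pi * \<i> * (1 / (x - cis (- 2 * pi * t) * y))"
      using nz by (simp add: divide_inverse mult_ac)
  qed
  from has_integral_mult_right[OF this, of "1 / (2 * pi * \<i>)"] show ?thesis
    by simp
qed

section \<open>Newton's theorem for the gauge potential\<close>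

lemma lborel_distr_minus:
  fixes c :: "'a::euclidean_space"
  shows "distr lborel borel (\<lambda>y. c - y) = lborel"
proof -
  have "(lborel :: 'a measure) = density (distr lborel borel (\<lambda>y. c + (-1) *\<^sub>R y)) (\<lambda>_. ennreal (\<bar>-1\<bar> ^ DIM('a)))"
    by (rule lborel_affine) simp
  then show ?thesis by (simp add: density_1)
qed

text \<open>The circular mean of the Cauchy kernel is not determined on the circle |y| = |x|, which
  must therefore be null.\<close>

lemma AE_lborel_cmod_neq: "AE y in lborel. cmod y \<noteq> a"
proof -
  have "AE r in distr lborel borel cmod. r \<noteq> a"
    unfolding distr_lborel_cmod
    using AE_lborel_singleton[of a] by (subst AE_density) auto
  then show ?thesis by (simp add: AE_distr_iff)
qed

lemma integrable_inverse_cmod_near: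
  "integrable lborel (\<lambda>y::complex. indicator {..1} (cmod (x - y)) / cmod (x - y))"
proof -
  have "integrable lborel (\<lambda>r. indicator {0..1::real} r * (2 * pi))"
    by (intro integrable_mult_left) simp
  \<comment> \<open>The area factor r cancels the singularity 1 / r except at \<open>r = 0\<close>,
    where division by zero gives 0 instead of \<open>2 * pi\<close>; that point is discarded as a
    null set.\<close>
  also have "(\<lambda>r. indicator {0..1::real} r * (2 * pi))
      = (\<lambda>r. if r = 0 then 2 * pi else indicator {0..} r * (2 * pi * r * (indicator {..1} r / r)))"
    by (auto simp: indicator_def)
  finally have *: "integrable lborel (\<lambda>r::real. if r = 0 then 2 * pi else indicator {0..} r * (2 * pi * r * (indicator {..1} r / r)))" .
  have "integrable lborel (\<lambda>r::real. indicator {0..} r * (2 * pi * r * (indicator {..1} r / r)))"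
    by (rule integrable_cong_AE_imp[OF *]) (use AE_lborel_singleton[of 0] in auto)
  then have "integrable lborel (\<lambda>y::complex. indicator {..1} (cmod y) / cmod y)"
    by (subst integral_radial(2)) auto
  then have "integrable (distr lborel borel (\<lambda>y. x - y)) (\<lambda>y::complex. indicator {..1} (cmod y) / cmod y)"
    by (simp add: lborel_distr_minus)
  then show ?thesis
    by (subst (asm) integrable_distr_eq) auto
qed

text \<open>Split at distance 1 from \<open>x\<close>: nearby, the bound on \<open>g\<close> leaves
  the locally integrable 1 / |x - y|; farther away, the kernel is at most 1 and \<open>g\<close>
  itself is integrable.\<close>

lemma integrable_radial_Cauchy_kernel:
  fixes g :: "real \<Rightarrow> real" and x :: complex
  assumes [measurable]: "g \<in> borel_measurable borel"
    and bound: "\<And>r. \<bar>g r\<bar> \<le> B" and int: "integrable lborel (\<lambda>y::complex. g (cmod y))"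
  shows "integrable lborel (\<lambda>y. complex_of_real (g (cmod y)) / (x - y))"
proof (rule Bochner_Integration.integrable_bound)
  show "integrable lborel (\<lambda>y. B * (indicator {..1} (cmod (x - y)) / cmod (x - y)) + \<bar>g (cmod y)\<bar>)"
    using int by (intro Bochner_Integration.integrable_add integrable_mult_right
      integrable_inverse_cmod_near integrable_abs)
  have B: "B \<ge> 0" using bound[of 0] by linarith
  show "AE y in lborel. norm (complex_of_real (g (cmod y)) / (x - y))
      \<le> norm (B * (indicator {..1} (cmod (x - y)) / cmod (x - y)) + \<bar>g (cmod y)\<bar>)"
  proof (rule AE_I2)
    fix y :: complex
    have "norm (complex_of_real (g (cmod y)) / (x - y)) \<le> B * (indicator {..1} (cmod (x - y)) / cmod (x - y)) + \<bar>g (cmod y)\<bar>"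
    proof (cases "cmod (x - y) \<le> 1")
      case True
      then show ?thesis using bound[of "cmod y"] 
        by (simp add: norm_divide add_increasing2 divide_right_mono)
    next
      case False
      then have "\<bar>g (cmod y)\<bar> / cmod (x - y) \<le> \<bar>g (cmod y)\<bar> / 1"
        by (intro divide_left_mono) auto
      then show ?thesis using False by (simp add: norm_divide)
    qed
    then show "norm (complex_of_real (g (cmod y)) / (x - y))
      \<le> norm (B * (indicator {..1} (cmod (x - y)) / cmod (x - y)) + \<bar>g (cmod y)\<bar>)"
      by simp
  qed
qed measurable

text \<open>Rotating \<open>y\<close> changes neither the integral nor the radial weight, so the
  kernel may be replaced by its mean over the circle. That mean sees the inner mass as a point
  charge at the origin and ignores the outer mass.\<close>

lemma integral_radial_Cauchy_kernel:
  fixes g :: "real \<Rightarrow> real" and x :: complex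
  assumes g[measurable]: "g \<in> borel_measurable borel"
    and bound: "\<And>r. \<bar>g r\<bar> \<le> B" and int: "integrable lborel (\<lambda>y::complex. g (cmod y))"
    and x: "x \<noteq> 0"
  shows "(LINT y|lborel. complex_of_real (g (cmod y)) / (x - y))
    = (LINT y|lborel. indicator {..<cmod x} (cmod y) * g (cmod y)) / x"
proof -
  define k :: "complex \<Rightarrow> complex" where "k y = complex_of_real (g (cmod y)) / (x - y)" for y
  define w where "w t = cis (- 2 * pi * t)" for t
  have w1: "cmod (w t) = 1" for t by (simp add: w_def)
  have wm[measurable]: "w \<in> borel_measurable borel"
    unfolding w_def by (intro borel_measurable_continuous_onI continuous_intros)
  have k: "integrable lborel k"
    unfolding k_def by (rule integrable_radial_Cauchy_kernel[OF g bound int])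
  have km[measurable]: "k \<in> borel_measurable borel" unfolding k_def by measurable
  have rot: "integrable lborel (\<lambda>y. k (w t * y))" "(LINT y|lborel. k (w t * y)) = (LINT y|lborel. k y)"
    "(LINT y|lborel. norm (k (w t * y))) = (LINT y|lborel. norm (k y))" for t
  proof -
    note d = lborel_distr_rotate[OF w1[of t]]
    show "integrable lborel (\<lambda>y. k (w t * y))"
      using k by (subst (asm) d[symmetric], subst (asm) integrable_distr_eq) auto
    show "(LINT y|lborel. k (w t * y)) = (LINT y|lborel. k y)"
      by (subst (2) d[symmetric], subst integral_distr) auto
    show "(LINT y|lborel. norm (k (w t * y))) = (LINT y|lborel. norm (k y))"
      by (subst (2) d[symmetric], subst integral_distr) auto
  qed
  define f where "f t y = indicator {0..1} t *\<^sub>R k (w t * y)" for t :: real and y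
  have fm[measurable]: "case_prod f \<in> borel_measurable (lborel \<Otimes>\<^sub>M lborel)"
    unfolding f_def by measurable
  \<comment> \<open>All rotated kernels have the same L^1 norm, so the inner integral of the norm is
    constant on \<open>{0..1}\<close>.\<close>
  have fi: "integrable (lborel \<Otimes>\<^sub>M lborel) (case_prod f)"
  proof (rule lborel_pair.Fubini_integrable)
    have "integrable lborel (\<lambda>t. indicator {0..1::real} t * (LINT y|lborel. norm (k y)))"
      by (intro integrable_mult_left) simp
    then show "integrable lborel (\<lambda>t. LINT y|lborel. norm (case (t, y) of (t, y) \<Rightarrow> f t y))"
      by (simp add: f_def rot)
  qed (auto simp: f_def rot)
  have "(LINT y|lborel. k y) = (LINT t|lborel. indicator {0..1::real} t *\<^sub>R (LINT y|lborel. k y))"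
    by simp
  also have "\<dots> = (LINT t|lborel. LINT y|lborel. f t y)"
    by (simp add: f_def rot)
  also have "\<dots> = (LINT y|lborel. LINT t|lborel. f t y)"
    by (rule lborel_pair.Fubini_integral[symmetric, OF fi])
  also have "\<dots> = (LINT y|lborel. complex_of_real (indicator {..<cmod x} (cmod y) * g (cmod y)) / x)"
  proof (rule integral_cong_AE)
    show "AE y in lborel. (LINT t|lborel. f t y) = complex_of_real (indicator {..<cmod x} (cmod y) * g (cmod y)) / x"
      using AE_lborel_cmod_neq[of "cmod x"]
    proof eventually_elim
      fix y assume ne: "cmod y \<noteq> cmod x"
      let ?h = "\<lambda>t. 1 / (x - cis (- 2 * pi * t) * y)"
      have nz: "x - cis (- 2 * pi * t) * y \<noteq> 0" for t
      proof
        assume "x - cis (- 2 * pi * t) * y = 0"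
        then have "cmod x = cmod y" by (metis eq_iff_diff_eq_0 norm_cis norm_mult mult_1)
        then show False using ne by simp
      qed
      have "set_integrable lborel {0..1} ?h"
        by (rule borel_integrable_atLeastAtMost') (use nz in \<open>intro continuous_intros, auto\<close>)
      then have "(LINT t:{0..1}|lborel. ?h t) = integral {0..1} ?h"
        by (rule set_borel_integral_eq_integral)
      also have "\<dots> = (if cmod y < cmod x then 1 / x else 0)"
        using has_integral_circle_Cauchy_kernel[of x y] ne x by (intro integral_unique) auto
      finally have eq: "(LINT t|lborel. indicator {0..1} t *\<^sub>R ?h t) = (if cmod y < cmod x then 1 / x else 0)"
        by (simp add: set_lebesgue_integral_def)
      have "f t y = g (cmod y) * (indicator {0..1} t *\<^sub>R ?h t)" for t
        by (simp add: f_def k_def w_def norm_mult scaleR_conv_of_real)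
      then have "(LINT t|lborel. f t y) = (LINT t|lborel. g (cmod y) * (indicator {0..1} t *\<^sub>R ?h t))"
        by (intro Bochner_Integration.integral_cong refl)
      also have "\<dots> = g (cmod y) * (LINT t|lborel. indicator {0..1} t *\<^sub>R ?h t)"
        by (rule integral_mult_right_zero)
      finally have "(LINT t|lborel. f t y) = g (cmod y) * (LINT t|lborel. indicator {0..1} t *\<^sub>R ?h t)" .
      then show "(LINT t|lborel. f t y) = complex_of_real (indicator {..<cmod x} (cmod y) * g (cmod y)) / x"
        unfolding eq by (simp add: indicator_def)
    qed
  next
    show "(\<lambda>y. LINT t|lborel. f t y) \<in> borel_measurable lborel"
      by (rule lborel.borel_measurable_lebesgue_integral) measurable
  qed measurable
  also have "\<dots> = complex_of_real (LINT y|lborel. indicator {..<cmod x} (cmod y) * g (cmod y)) / x"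
    by (simp del: of_real_mult)
  finally show ?thesis by (simp add: k_def)
qed

lemma perp_eq: "perp z = \<i> * z"
  by (simp add: perp_def complex_eq_iff)

text \<open>The vector kernel is a Cauchy kernel in disguise: perp z / |z|^2 = i cnj (1 / z). As it
  is integrable against \<open>g\<close>, dominated convergence removes the truncation.\<close>

lemma gauge_potential_radial:
  fixes g :: "real \<Rightarrow> real" and x :: complex
  assumes g[measurable]: "g \<in> borel_measurable borel"
    and bound: "\<And>r. \<bar>g r\<bar> \<le> B" and int: "integrable lborel (\<lambda>y::complex. g (cmod y))"
    and x: "x \<noteq> 0"
  shows "gauge_potential (\<lambda>y. g (cmod y)) x
    = ((LINT y|lborel. indicator {..<cmod x} (cmod y) * g (cmod y)) / (cmod x)\<^sup>2) *\<^sub>R perp x"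
proof -
  have perp: "(c / (cmod z)\<^sup>2) *\<^sub>R perp z = \<i> * cnj (complex_of_real c / z)" for c z
    by (cases "z = 0")
       (auto simp: perp_eq scaleR_conv_of_real complex_norm_square[symmetric] field_simps power2_eq_square
             simp flip: complex_norm_square)
  define h where "h y = \<i> * cnj (complex_of_real (g (cmod y)) / (x - y))" for y
  have k: "integrable lborel (\<lambda>y. complex_of_real (g (cmod y)) / (x - y))"
    by (rule integrable_radial_Cauchy_kernel[OF g bound int])
  then have h: "integrable lborel h"
    unfolding h_def by (intro integrable_mult_right integrable_cnj)
  have hm[measurable]: "h \<in> borel_measurable borel" using h by auto
  have "((\<lambda>\<epsilon>. LINT y:{y. dist x y > \<epsilon>}|lborel. h y) \<longlongrightarrow> (LINT y|lborel. h y)) (at_right 0)"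
  proof (rule tendsto_at_right_sequentially[of 0 1])
    fix S :: "nat \<Rightarrow> real"
    assume S: "\<And>n. 0 < S n" "S \<longlonglongrightarrow> 0"
    show "(\<lambda>n. LINT y:{y. dist x y > S n}|lborel. h y) \<longlonglongrightarrow> (LINT y|lborel. h y)"
      unfolding set_lebesgue_integral_def
    proof (rule integral_dominated_convergence[where w = "\<lambda>y. norm (h y)"])
      show "AE y in lborel. (\<lambda>n. indicator {y. dist x y > S n} y *\<^sub>R h y) \<longlonglongrightarrow> h y"
      proof (rule AE_I2)
        fix y
        show "(\<lambda>n. indicator {y. dist x y > S n} y *\<^sub>R h y) \<longlonglongrightarrow> h y"
        \<comment> \<open>At \<open>y = x\<close> division by zero makes \<open>h y\<close> vanish,
          so the truncated integrands converge there as well.\<close>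
        proof (cases "y = x")
          case False
          then have "eventually (\<lambda>n. S n < dist x y) sequentially"
            using S(2) by (intro order_tendstoD) auto
          then have "eventually (\<lambda>n. indicator {y. dist x y > S n} y *\<^sub>R h y = h y) sequentially"
            by eventually_elim auto
          then show ?thesis by (rule tendsto_eventually)
        qed (simp add: h_def)
      qed
      show "integrable lborel (\<lambda>y. norm (h y))" using h by simp
      show "AE y in lborel. norm (indicator {y. dist x y > S n} y *\<^sub>R h y) \<le> norm (h y)" for n
        by (auto simp: indicator_def)
    qed auto
  qed simp
  then have "gauge_potential (\<lambda>y. g (cmod y)) x = (LINT y|lborel. h y)"
    unfolding gauge_potential_def h_def perp by (intro tendsto_Lim) auto
  also have "\<dots> = \<i> * cnj (LINT y|lborel. complex_of_real (g (cmod y)) / (x - y))"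
    unfolding h_def by (simp only: integral_mult_right_zero Bochner_Integration.integral_cnj)
  also have "\<dots> = ((LINT y|lborel. indicator {..<cmod x} (cmod y) * g (cmod y)) / (cmod x)\<^sup>2) *\<^sub>R perp x"
    by (simp add: perp integral_radial_Cauchy_kernel[OF g bound int x])
  finally show ?thesis .
qed

section \<open>Test functions and uniqueness of weak derivatives\<close>

text \<open>The induction on \<open>k\<close> runs over all members of \<open>P\<close> at once,
  because it passes from \<open>f\<close> to its partial derivatives.\<close>

lemma C_k_closed:
  assumes "P f"
    and diff: "\<And>f. P f \<Longrightarrow> f differentiable_on UNIV"
    and deriv: "\<And>f e. P f \<Longrightarrow> e \<in> Basis \<Longrightarrow> P (\<lambda>x. frechet_derivative f (at x) e)"
  shows "C_k k f"
  using assms(1)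
proof (induction k arbitrary: f)
  case 0
  then show ?case by (simp add: diff differentiable_imp_continuous_on)
next
  case (Suc k)
  have "C_k k (\<lambda>x. frechet_derivative f (at x) e)" if "e \<in> Basis" for e
    by (rule Suc.IH) (rule deriv[OF Suc.prems that])
  then show ?case using diff[OF Suc.prems] by simp
qed

text \<open>For the product rule, where each term keeps one undifferentiated factor that has to be
  lowered to order \<open>k\<close>.\<close>

lemma C_k_Suc_imp: "C_k (Suc k) f \<Longrightarrow> C_k k f"
proof (induction k arbitrary: f)
  case 0
  then show ?case by (simp add: differentiable_imp_continuous_on)
next
  case (Suc k)
  have "C_k k (\<lambda>x. frechet_derivative f (at x) e)" if "e \<in> Basis" for e
    by (rule Suc.IH) (use Suc.prems that in \<open>subst (asm) C_k.simps, blast\<close>)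
  moreover have "f differentiable_on UNIV"
    using Suc.prems by (subst (asm) C_k.simps) blast
  ultimately show ?case by simp
qed

lemma C_k_add:
  assumes "C_k k f" "C_k k g"
  shows "C_k k (\<lambda>x. f x + g x)"
  using assms
proof (induction k arbitrary: f g)
  case 0
  then show ?case by (auto intro: continuous_intros)
next
  case (Suc k)
  then have d: "f differentiable at x" "g differentiable at x" for x
    by (auto simp: differentiable_on_def)
  have "frechet_derivative (\<lambda>x. f x + g x) (at x) e
      = frechet_derivative f (at x) e + frechet_derivative g (at x) e" for x e
    by (rule fun_cong[OF frechet_derivative_at[symmetric]])
       (intro has_derivative_add d[unfolded frechet_derivative_works])
  moreover have "C_k k (\<lambda>x. frechet_derivative f (at x) e + frechet_derivative g (at x) e)"
    if "e \<in> Basis" for e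
    using Suc.prems that by (intro Suc.IH) auto
  ultimately show ?case using d by (simp add: differentiable_on_def)
qed

lemma C_k_mult:
  assumes "C_k k f" "C_k k g"
  shows "C_k k (\<lambda>x. f x * g x)"
  using assms
proof (induction k arbitrary: f g)
  case 0
  then show ?case by (auto intro: continuous_intros)
next
  case (Suc k)
  then have d: "f differentiable at x" "g differentiable at x" for x
    by (auto simp: differentiable_on_def)
  have "frechet_derivative (\<lambda>x. f x * g x) (at x) e
      = f x * frechet_derivative g (at x) e + frechet_derivative f (at x) e * g x" for x e
    by (rule fun_cong[OF frechet_derivative_at[symmetric]])
       (intro has_derivative_mult d[unfolded frechet_derivative_works])
  moreover have "C_k k (\<lambda>x. f x * frechet_derivative g (at x) e + frechet_derivative f (at x) e * g x)"
    if "e \<in> Basis" for e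
    using Suc.prems that C_k_Suc_imp[of k f] C_k_Suc_imp[of k g] by (intro C_k_add Suc.IH) auto
  ultimately show ?case using d by (simp add: differentiable_on_def)
qed

text \<open>The polynomial factor is there to make the family closed under differentiation; the bump
  functions only use \<open>p = 1\<close>.\<close>

definition flat :: "real poly \<Rightarrow> real \<Rightarrow> real" where
  "flat p t = (if t > 0 then poly p (1 / t) * exp (- (1 / t)) else 0)"

lemma poly_times_exp_minus_tendsto_0: "((\<lambda>s::real. poly p s * exp (- s)) \<longlongrightarrow> 0) at_top"
proof -
  have "((\<lambda>s::real. \<Sum>i\<le>degree p. coeff p i * (s ^ i / exp s)) \<longlongrightarrow> (\<Sum>i\<le>degree p. coeff p i * 0)) at_top"
    by (intro tendsto_sum tendsto_mult tendsto_const tendsto_power_div_exp_0)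
  then show ?thesis
    by (simp add: poly_altdef sum_divide_distrib exp_minus divide_inverse[symmetric])
qed

lemma flat_tendsto_0: "(flat p \<longlongrightarrow> 0) (at_right 0)"
proof -
  have "((\<lambda>t. poly p (inverse t) * exp (- inverse t)) \<longlongrightarrow> 0) (at_right (0::real))"
    by (rule filterlim_compose[OF poly_times_exp_minus_tendsto_0 filterlim_inverse_at_top_right])
  then show ?thesis
    by (rule Lim_transform_eventually)
       (auto simp: flat_def eventually_at_right_less divide_inverse intro: eventually_at_rightI[of 0 1])
qed

text \<open>With s = 1 / t one has ds/dt = - s^2, so p(s) e^(-s) has derivative s^2 (p - p')(s)
  e^(-s), and \<open>[:0, 0, 1:]\<close> is the polynomial s^2. At 0 the difference quotient from
  the right is again flat, for the polynomial s p(s).\<close>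

lemma has_real_derivative_flat:
  "(flat p has_real_derivative flat ([:0, 0, 1:] * (p - pderiv p)) t) (at t)"
proof -
  consider "t < 0" | "t = 0" | "t > 0" by linarith
  then show ?thesis
  proof cases
    case 1
    have "((\<lambda>_. 0) has_real_derivative 0) (at t)" by simp
    then have "(flat p has_real_derivative 0) (at t)"
      by (rule has_field_derivative_transform_within_open[of _ _ _ "{..<0}"]) (use 1 in \<open>auto simp: flat_def\<close>)
    then show ?thesis using 1 by (simp add: flat_def)
  next
    case 3
    have "((\<lambda>t. poly p (1 / t) * exp (- (1 / t))) has_real_derivative
        flat ([:0, 0, 1:] * (p - pderiv p)) t) (at t)"
    proof -
      have d: "((\<lambda>t. 1 / t) has_real_derivative - (1 / t\<^sup>2)) (at t)"
        using 3 by (auto intro!: derivative_eq_intros simp: power2_eq_square)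
      have "((\<lambda>t. exp (- (1 / t))) has_real_derivative exp (- (1 / t)) * (1 / t\<^sup>2)) (at t)"
        using DERIV_fun_exp[OF DERIV_minus[OF d]] by simp
      from DERIV_mult[OF DERIV_chain2[OF poly_DERIV d] this] show ?thesis
        by (rule DERIV_cong) (use 3 in \<open>simp add: flat_def power2_eq_square algebra_simps\<close>)
    qed
    then show ?thesis
      by (rule has_field_derivative_transform_within_open[of _ _ _ "{0<..}"]) (use 3 in \<open>auto simp: flat_def\<close>)
  next
    case 2
    have "((\<lambda>h. (flat p h - flat p 0) / h) \<longlongrightarrow> 0) (at 0)"
    proof (subst filterlim_at_split, intro conjI)
      show "((\<lambda>h. (flat p h - flat p 0) / h) \<longlongrightarrow> 0) (at_left 0)"
        by (rule tendsto_eventually) (auto simp: flat_def intro: eventually_at_leftI[of "-1"])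
      show "((\<lambda>h. (flat p h - flat p 0) / h) \<longlongrightarrow> 0) (at_right 0)"
        by (rule Lim_transform_eventually[OF flat_tendsto_0[of "pCons 0 p"]])
           (auto simp: flat_def intro: eventually_at_rightI[of 0 1])
    qed
    then show ?thesis using 2 by (simp add: has_field_derivative_iff flat_def)
  qed
qed

lemma C_k_flat_affine: "C_k k (\<lambda>x. flat p (x \<bullet> a + b))"
proof -
  \<comment> \<open>The factor \<open>c\<close> absorbs the inner product
    \<open>e \<bullet> a\<close> that each differentiation produces, while \<open>p\<close> varies
    with the order.\<close>
  define P where "P f \<longleftrightarrow> (\<exists>c p. f = (\<lambda>x. c * flat p (x \<bullet> a + b)))" for f :: "complex \<Rightarrow> real"
  have der: "((\<lambda>x. c * flat p (x \<bullet> a + b)) has_derivative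
    (\<lambda>h. c * ((h \<bullet> a) * flat ([:0, 0, 1:] * (p - pderiv p)) (x \<bullet> a + b)))) (at x)" for c p and x :: complex
  proof -
    have "((\<lambda>x. flat p (x \<bullet> a + b)) has_derivative
      (\<lambda>h. (h \<bullet> a) *\<^sub>R flat ([:0, 0, 1:] * (p - pderiv p)) (x \<bullet> a + b))) (at x)"
      by (rule has_derivative_compose[of "\<lambda>x. x \<bullet> a + b", OF _
            has_real_derivative_flat[unfolded has_field_derivative_def], THEN has_derivative_eq_rhs])
         (auto intro!: derivative_eq_intros)
    from has_derivative_mult_right[OF this, of c] show ?thesis by simp
  qed
  show ?thesis
  proof (rule C_k_closed[where P = P])
    show "P (\<lambda>x. flat p (x \<bullet> a + b))" unfolding P_def by (intro exI[of _ 1] exI[of _ p]) simp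
    fix f assume "P f"
    then obtain c p where f: "f = (\<lambda>x. c * flat p (x \<bullet> a + b))" by (auto simp: P_def)
    show "f differentiable_on UNIV"
      unfolding f differentiable_on_def differentiable_def using der by blast
    fix e :: complex
    have "(\<lambda>x. frechet_derivative f (at x) e)
        = (\<lambda>x. (c * (e \<bullet> a)) * flat ([:0, 0, 1:] * (p - pderiv p)) (x \<bullet> a + b))"
      unfolding f by (subst frechet_derivative_at[OF der, symmetric]) (simp add: mult_ac)
    then show "P (\<lambda>x. frechet_derivative f (at x) e)"
      unfolding P_def by blast
  qed
qed

section \<open>Smooth bumps converging to the indicator of a box\<close>

text \<open>For \<open>n > 0\<close> each factor is exp (- 1 / (n d)) if the signed distance d to
  one side of the box is positive, and 0 otherwise. Increasing \<open>n\<close> pushes the factor to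
  1 without moving the support.\<close>

definition box_bump :: "complex \<Rightarrow> complex \<Rightarrow> nat \<Rightarrow> complex \<Rightarrow> real" where
  "box_bump p q n x = flat 1 (real n * (Re x - Re p)) * flat 1 (real n * (Re q - Re x)) *
     (flat 1 (real n * (Im x - Im p)) * flat 1 (real n * (Im q - Im x)))"

lemma flat_1_bounds: "0 \<le> flat 1 t" "flat 1 t \<le> 1"
  by (auto simp: flat_def)

lemma box_bump_eq_0: "x \<notin> box p q \<Longrightarrow> box_bump p q n x = 0"
  by (auto simp: box_bump_def flat_def box_def Basis_complex_def zero_less_mult_iff)

lemma box_bump_bounds: "0 \<le> box_bump p q n x" "box_bump p q n x \<le> 1"
  unfolding box_bump_def by (auto intro!: mult_nonneg_nonneg mult_le_one flat_1_bounds)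

lemma box_bump_tendsto: "(\<lambda>n. box_bump p q n x) \<longlonglongrightarrow> indicator (box p q) x"
proof (cases "x \<in> box p q")
  case True
  have *: "(\<lambda>n. flat 1 (real n * t)) \<longlonglongrightarrow> 1" if "t > 0" for t
  proof -
    have "(\<lambda>n. exp (- (inverse (real n) * (1 / t)))) \<longlonglongrightarrow> exp (- (0 * (1 / t)))"
      by (intro tendsto_intros lim_inverse_n)
    then have "(\<lambda>n. exp (- (1 / (real n * t)))) \<longlonglongrightarrow> 1"
      by (simp add: divide_inverse mult_ac)
    then show ?thesis
      by (rule Lim_transform_eventually)
         (use that in \<open>auto simp: flat_def intro!: eventually_sequentiallyI[of 1]\<close>)
  qed
  have "(\<lambda>n. box_bump p q n x) \<longlonglongrightarrow> 1 * 1 * (1 * 1)"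
    unfolding box_bump_def
    by (intro tendsto_mult *) (use True in \<open>auto simp: box_def Basis_complex_def\<close>)
  then show ?thesis using True by simp
qed (simp add: box_bump_eq_0)

lemma box_bump_test_function: "box_bump p q n \<in> test_functions"
proof -
  have "closure {x. box_bump p q n x \<noteq> 0} \<subseteq> cbox p q"
    by (rule closure_minimal) (use box_bump_eq_0[of _ p q n] box_subset_cbox[of p q] in auto)
  then have "compact (closure {x. box_bump p q n x \<noteq> 0})"
    by (metis closed_closure compact_Int_closed compact_cbox inf.absorb_iff2)
  moreover have "C_k k (box_bump p q n)" for k
  proof -
    have "C_k k (\<lambda>x. flat 1 (x \<bullet> of_real (real n) + - (real n * Re p)) * flat 1 (x \<bullet> of_real (- real n) + real n * Re q) *
     (flat 1 (x \<bullet> Complex 0 (real n) + - (real n * Im p)) * flat 1 (x \<bullet> Complex 0 (- real n) + real n * Im q)))"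
      by (intro C_k_mult C_k_flat_affine)
    then show ?thesis
      by (simp add: box_bump_def[abs_def] inner_complex_def algebra_simps)
  qed
  ultimately show ?thesis by (simp add: test_functions_def)
qed

text \<open>The positive and the negative part of \<open>f\<close> are densities of two measures
  that agree on boxes, hence everywhere. Since \<open>ennreal\<close> sends negative numbers to 0,
  equality of the densities at a point forces \<open>f x = 0\<close>.\<close>

lemma AE_zero_if_box_integrals_zero:
  fixes f :: "'a::euclidean_space \<Rightarrow> real"
  assumes int: "\<And>p q. integrable lborel (\<lambda>x. indicator (box p q) x * f x)"
    and zero: "\<And>p q. (LINT x|lborel. indicator (box p q) x * f x) = 0"
    and f[measurable]: "f \<in> borel_measurable borel"
  shows "AE x in lborel. f x = 0"
proof -
  have em: "emeasure (density lborel (\<lambda>x. ennreal (g x))) (box p q)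
      = (\<integral>\<^sup>+x. ennreal (indicator (box p q) x * g x) \<partial>lborel)"
    if [measurable]: "g \<in> borel_measurable borel" for g :: "'a \<Rightarrow> real" and p q
    by (subst emeasure_density) (auto simp: indicator_def intro!: nn_integral_cong)
  have fin: "(\<integral>\<^sup>+x. ennreal (indicator (box p q) x * f x) \<partial>lborel) \<noteq> \<infinity>"
    "(\<integral>\<^sup>+x. ennreal (- (indicator (box p q) x * f x)) \<partial>lborel) \<noteq> \<infinity>" for p q
    using int[of p q] by (auto simp: real_integrable_def)
  have "density lborel (\<lambda>x. ennreal (f x)) = density lborel (\<lambda>x. ennreal (- f x))"
  proof (rule measure_eqI_generator_eq[where \<Omega> = UNIV and E = "range (\<lambda>(a, b). box a b)"
        and A = "\<lambda>n::nat. box (- (real n *\<^sub>R One)) (real n *\<^sub>R One)"])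
    show "Int_stable (range (\<lambda>(a, b). box a b :: 'a set))"
      unfolding Int_stable_def by (auto simp: box_Int_box)
    fix X :: "'a set" assume "X \<in> range (\<lambda>(a, b). box a b)"
    then obtain p q where X: "X = box p q" by auto
    have enn2real_eq: "a = b" if "enn2real a = enn2real b" "a \<noteq> \<infinity>" "b \<noteq> \<infinity>" for a b
      using that by (cases a; cases b) auto
    have "enn2real (\<integral>\<^sup>+x. ennreal (indicator (box p q) x * f x) \<partial>lborel)
        = enn2real (\<integral>\<^sup>+x. ennreal (- (indicator (box p q) x * f x)) \<partial>lborel)"
      using zero[of p q] by (simp add: real_lebesgue_integral_def[OF int])
    then have "(\<integral>\<^sup>+x. ennreal (indicator (box p q) x * f x) \<partial>lborel)
        = (\<integral>\<^sup>+x. ennreal (- (indicator (box p q) x * f x)) \<partial>lborel)"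
      using fin[of p q] by (rule enn2real_eq)
    then show "emeasure (density lborel (\<lambda>x. ennreal (f x))) X
        = emeasure (density lborel (\<lambda>x. ennreal (- f x))) X"
      unfolding X by (simp add: em)
  next
    show "emeasure (density lborel (\<lambda>x. ennreal (f x))) (box (- (real n *\<^sub>R One)) (real n *\<^sub>R One)) \<noteq> \<infinity>" for n
      using fin(1) by (simp add: em)
  next
    show "(\<Union>n. box (- (real n *\<^sub>R One)) (real n *\<^sub>R One :: 'a)) = UNIV"
      by (rule UN_box_eq_UNIV)
  qed (auto simp: borel_eq_box)
  then have "AE x in lborel. ennreal (f x) = ennreal (- f x)"
    by (intro sigma_finite_measure.density_unique[OF sigma_finite_lborel]) auto
  then show ?thesis
  proof eventually_elim
    case (elim x)
    then show ?case by (cases "f x" "0::real" rule: linorder_cases) (auto simp: ennreal_neg ennreal_eq_0_iff)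
  qed
qed

lemma integrable_box_if_L2:
  assumes "v \<in> L2"
  shows "integrable lborel (\<lambda>x. indicator (box p q) x *\<^sub>R v x)"
proof (rule Bochner_Integration.integrable_bound)
  have [measurable]: "v \<in> borel_measurable borel" using assms by (simp add: L2_def)
  show "(\<lambda>x. indicator (box p q) x *\<^sub>R v x) \<in> borel_measurable lborel" by measurable
  show "integrable lborel (\<lambda>x. indicator (box p q) x + (cmod (v x))\<^sup>2)"
    using assms by (intro Bochner_Integration.integrable_add)
      (auto simp: L2_def emeasure_lborel_box_eq ennreal_mult_less_top intro!: integrable_real_indicator)
  show "AE x in lborel. norm (indicator (box p q) x *\<^sub>R v x) \<le> norm (indicator (box p q) x + (cmod (v x))\<^sup>2)"
  proof (rule AE_I2)
    fix x
    \<comment> \<open>From (|v| - 1/2)^2 \<ge> 0, which even gives 1/4 in place of 1.\<close>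
    have "cmod (v x) \<le> 1 + (cmod (v x))\<^sup>2"
      using zero_le_power2[of "cmod (v x) - 1 / 2"] by (simp add: power2_eq_square algebra_simps)
    then show "norm (indicator (box p q) x *\<^sub>R v x) \<le> norm (indicator (box p q) x + (cmod (v x))\<^sup>2)"
      by (auto simp: indicator_def)
  qed
qed

text \<open>Both candidates have the same integral against every box bump. Letting the bumps tend to
  the indicator, dominated by the difference on the box, shows that the difference has integral zero
  over every box.\<close>

lemma weak_partial_unique:
  assumes v: "v \<in> L2" "is_weak_partial e u v" and w: "w \<in> L2" "is_weak_partial e u w"
  shows "AE x in lborel. v x = w x"
proof -
  note [measurable] = v(1)[unfolded L2_def, simplified, THEN conjunct1] w(1)[unfolded L2_def, simplified, THEN conjunct1]
  have bump_int: "integrable lborel (\<lambda>x. box_bump p q n x *\<^sub>R g x)"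
    if "g \<in> L2" for p q n g
  proof (rule Bochner_Integration.integrable_bound[OF integrable_box_if_L2[OF that, of p q]])
    have "box_bump p q n \<in> borel_measurable borel"
      using box_bump_test_function[of p q n] unfolding test_functions_def
      by (auto intro!: borel_measurable_continuous_onI dest!: spec[of _ 0])
    moreover have "g \<in> borel_measurable borel" using that by (simp add: L2_def)
    ultimately show "(\<lambda>x. box_bump p q n x *\<^sub>R g x) \<in> borel_measurable lborel" by simp
    show "AE x in lborel. norm (box_bump p q n x *\<^sub>R g x) \<le> norm (indicator (box p q) x *\<^sub>R g x)"
      using box_bump_bounds[of p q n] by (auto simp: indicator_def box_bump_eq_0 mult_left_le_one_le)
  qed
  let ?d = "\<lambda>x. v x - w x"
  have zero_n: "(LINT x|lborel. box_bump p q n x *\<^sub>R ?d x) = 0" for p q n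
  proof -
    have "(LINT x|lborel. box_bump p q n x *\<^sub>R v x) = (LINT x|lborel. box_bump p q n x *\<^sub>R w x)"
      using v(2) w(2) box_bump_test_function[of p q n] by (simp add: is_weak_partial_def)
    then show ?thesis
      by (simp add: scaleR_diff_right bump_int v w)
  qed
  have dint: "integrable lborel (\<lambda>x. indicator (box p q) x *\<^sub>R ?d x)" for p q
    using integrable_box_if_L2[OF v(1), of p q] integrable_box_if_L2[OF w(1), of p q]
    by (simp add: scaleR_diff_right)
  have zero: "(LINT x|lborel. indicator (box p q) x *\<^sub>R ?d x) = 0" for p q
  proof -
    have "(\<lambda>n. LINT x|lborel. box_bump p q n x *\<^sub>R ?d x) \<longlonglongrightarrow> (LINT x|lborel. indicator (box p q) x *\<^sub>R ?d x)"
    proof (rule integral_dominated_convergence[where w = "\<lambda>x. norm (indicator (box p q) x *\<^sub>R ?d x)"])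
      show "integrable lborel (\<lambda>x. norm (indicator (box p q) x *\<^sub>R ?d x))"
        by (rule integrable_norm[OF dint])
      show "(\<lambda>x. box_bump p q n x *\<^sub>R ?d x) \<in> borel_measurable lborel" for n
        using bump_int[OF v(1), of p q n] bump_int[OF w(1), of p q n] by (simp add: scaleR_diff_right)
      show "AE x in lborel. (\<lambda>n. box_bump p q n x *\<^sub>R ?d x) \<longlonglongrightarrow> indicator (box p q) x *\<^sub>R ?d x"
        by (intro AE_I2 tendsto_scaleR box_bump_tendsto tendsto_const)
      show "AE x in lborel. norm (box_bump p q n x *\<^sub>R ?d x) \<le> norm (indicator (box p q) x *\<^sub>R ?d x)" for n
        using box_bump_bounds[of p q n] by (auto simp: indicator_def box_bump_eq_0 mult_left_le_one_le)
    qed measurable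
    then show ?thesis by (simp add: zero_n LIMSEQ_const_iff)
  qed
  have "AE x in lborel. Re (?d x) = 0"
  proof (rule AE_zero_if_box_integrals_zero)
    show "integrable lborel (\<lambda>x. indicator (box p q) x * Re (?d x))" for p q
      using integrable_Re[OF dint[of p q]] by simp
    show "(LINT x|lborel. indicator (box p q) x * Re (?d x)) = 0" for p q
      using integral_Re[OF dint[of p q]] zero[of p q] by simp
  qed measurable
  moreover have "AE x in lborel. Im (?d x) = 0"
  proof (rule AE_zero_if_box_integrals_zero)
    show "integrable lborel (\<lambda>x. indicator (box p q) x * Im (?d x))" for p q
      using integrable_Im[OF dint[of p q]] by simp
    show "(LINT x|lborel. indicator (box p q) x * Im (?d x)) = 0" for p q
      using integral_Im[OF dint[of p q]] zero[of p q] by simp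
  qed measurable
  ultimately show ?thesis
    by eventually_elim (simp add: complex_eq_iff)
qed

section \<open>Classical derivatives are weak derivatives\<close>

lemma has_derivative_eq_0_outside_support:
  assumes "(g has_derivative g') (at x)" "closed K" "\<And>x. x \<notin> K \<Longrightarrow> g x = 0" "x \<notin> K"
  shows "g' = (\<lambda>_. 0)"
proof (rule has_derivative_unique[OF assms(1)])
  have "((\<lambda>_. 0) has_derivative (\<lambda>_. 0)) (at x)" by simp
  then show "(g has_derivative (\<lambda>_. 0)) (at x)"
    by (rule has_derivative_transform_within_open[where s = "- K"]) (use assms in auto)
qed

lemma integrable_continuous_compact_support:
  fixes g :: "'a::euclidean_space \<Rightarrow> complex"
  assumes "continuous_on UNIV g" "compact K" "\<And>x. x \<notin> K \<Longrightarrow> g x = 0"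
  shows "integrable lborel g"
proof -
  have "integrable lborel (\<lambda>x. indicator K x *\<^sub>R g x)"
    by (rule borel_integrable_compact) (use assms continuous_on_subset[OF assms(1)] in auto)
  also have "(\<lambda>x. indicator K x *\<^sub>R g x) = g"
    using assms(3) by (auto simp: indicator_def)
  finally show ?thesis .
qed

text \<open>By translation invariance every difference quotient of \<open>g\<close> integrates to zero, so no Fubini
  argument over a line decomposition is needed.\<close>

lemma integral_directional_derivative_eq_0:
  fixes g :: "'a::euclidean_space \<Rightarrow> complex"
  assumes der: "\<And>x. (g has_derivative g' x) (at x)"
    and cont: "continuous_on UNIV (\<lambda>x. g' x e)"
    and K: "compact K" and supp: "\<And>x. x \<notin> K \<Longrightarrow> g x = 0"
  shows "(LINT x|lborel. g' x e) = 0"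
\<comment> \<open>The limit of the difference quotients below runs through nonzero increments
  \<open>s n *\<^sub>R e\<close>, so \<open>e = 0\<close> is treated apart.\<close>
proof (cases "e = 0")
  case True
  have "g' x 0 = 0" for x
    using der[of x] by (simp add: has_derivative_bounded_linear linear_simps)
  then show ?thesis using True by simp
next
  case False
  have cg: "continuous_on UNIV g"
    using has_derivative_continuous[OF der] by (simp add: continuous_at_imp_continuous_on)
  have [measurable]: "g \<in> borel_measurable borel"
    by (rule borel_measurable_continuous_onI[OF cg])
  have g_int: "integrable lborel g"
    by (rule integrable_continuous_compact_support[OF cg K supp])
  have supp': "g' x e = 0" if "x \<notin> K" for x
    using has_derivative_eq_0_outside_support[OF der compact_imp_closed[OF K] supp that] by simp
  obtain R where R: "\<And>x. x \<in> K \<Longrightarrow> norm x \<le> R"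
    using compact_imp_bounded[OF K] by (auto simp: bounded_iff)
  obtain B where B: "B > 0" "\<And>x. norm (g' x e) \<le> B"
  proof -
    have "bounded ((\<lambda>x. g' x e) ` K)"
      by (intro compact_imp_bounded compact_continuous_image K continuous_on_subset[OF cont]) simp
    then obtain B where "B > 0" "\<And>x. x \<in> K \<Longrightarrow> norm (g' x e) \<le> B"
      by (auto simp: bounded_pos)
    moreover from this have "norm (g' x e) \<le> B" for x
      using supp'[of x] by (cases "x \<in> K") auto
    ultimately show ?thesis using that by blast
  qed
  define s where "s n = 1 / real (Suc n)" for n
  have s: "0 < s n" "s n \<le> 1" for n by (simp_all add: s_def)
  define q where "q n x = (g (x + s n *\<^sub>R e) - g x) /\<^sub>R s n" for n x
  have qm[measurable]: "q n \<in> borel_measurable borel" for n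
    unfolding q_def by measurable
  have q0: "(LINT x|lborel. q n x) = 0" for n
  proof -
    have eq: "distr lborel borel (\<lambda>x. x + s n *\<^sub>R e) = (lborel :: 'a measure)"
      using lborel_distr_plus[of "s n *\<^sub>R e"] by (simp add: add.commute[of _ "s n *\<^sub>R e"])
    have "integrable (distr lborel borel (\<lambda>x. x + s n *\<^sub>R e)) g"
      unfolding eq by (rule g_int)
    then have "integrable lborel (\<lambda>x. g (x + s n *\<^sub>R e))"
      by (subst (asm) integrable_distr_eq) auto
    moreover have "(LINT x|lborel. g (x + s n *\<^sub>R e)) = (LINT x|lborel. g x)"
      by (subst (2) eq[symmetric], subst integral_distr) auto
    ultimately show ?thesis
      unfolding q_def using g_int by simp
  qed
  \<comment> \<open>The dominating function: the mean value inequality bounds the quotient by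
    \<open>B\<close>. As \<open>s n \<le> 1\<close>, it can be nonzero only within distance
    \<open>norm e\<close> of \<open>K\<close>, hence in the ball of radius
    \<open>R + norm e\<close>.\<close>
  have q_bound: "norm (q n x) \<le> B * indicator (cball 0 (R + norm e)) x" for n x
  proof (cases "norm x \<le> R + norm e")
    case True
    have "norm (g (x + s n *\<^sub>R e) - g (x + 0 *\<^sub>R e)) \<le> B * norm (s n - 0)"
    proof (rule differentiable_bound[where S = UNIV and f' = "\<lambda>t u. g' (x + t *\<^sub>R e) (u *\<^sub>R e)"])
      fix t :: real
      show "((\<lambda>t. g (x + t *\<^sub>R e)) has_derivative (\<lambda>u. g' (x + t *\<^sub>R e) (u *\<^sub>R e))) (at t within UNIV)"
        by (rule has_derivative_compose[OF _ der]) (auto intro!: derivative_eq_intros)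
      show "onorm (\<lambda>u. g' (x + t *\<^sub>R e) (u *\<^sub>R e)) \<le> B"
      proof (rule onorm_le)
        fix u :: real
        have "g' (x + t *\<^sub>R e) (u *\<^sub>R e) = u *\<^sub>R g' (x + t *\<^sub>R e) e"
          by (simp add: linear_simps(5)[OF has_derivative_bounded_linear[OF der]])
        then show "norm (g' (x + t *\<^sub>R e) (u *\<^sub>R e)) \<le> B * norm u"
          using mult_left_mono[OF B(2)[of "x + t *\<^sub>R e"] abs_ge_zero[of u]] by (simp add: mult.commute)
      qed
    qed auto
    then have "norm (g (x + s n *\<^sub>R e) - g x) / s n \<le> B"
      using s[of n] by (simp add: divide_le_eq)
    then show ?thesis using True s[of n] by (simp add: q_def divide_inverse mult.commute)
  next
    case False
    have "norm x \<le> norm (x + s n *\<^sub>R e) + norm (s n *\<^sub>R e)"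
      by (metis add_diff_cancel_right' norm_triangle_ineq4)
    moreover have "norm (s n *\<^sub>R e) \<le> norm e"
      using s[of n] by (simp add: mult_left_le_one_le)
    ultimately have "x + s n *\<^sub>R e \<notin> K" "x \<notin> K"
      using False R[of x] R[of "x + s n *\<^sub>R e"] norm_ge_zero[of e] by linarith+
    then show ?thesis using supp False by (simp add: q_def)
  qed
  have lim: "(\<lambda>n. q n x) \<longlonglongrightarrow> g' x e" for x
  proof -
    have s_lim: "s \<longlonglongrightarrow> 0" unfolding s_def by (rule LIMSEQ_Suc[OF lim_1_over_n])
    have "filterlim (\<lambda>n. s n *\<^sub>R e) (at 0) sequentially"
      unfolding filterlim_at
    proof
      show "\<forall>\<^sub>F n in sequentially. s n *\<^sub>R e \<in> UNIV \<and> s n *\<^sub>R e \<noteq> 0"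
        using s False by (intro always_eventually) (auto simp: less_le)
      show "(\<lambda>n. s n *\<^sub>R e) \<longlonglongrightarrow> 0"
        using tendsto_scaleR[OF s_lim tendsto_const[of e]] by simp
    qed
    moreover have "((\<lambda>h. norm (g (x + h) - g x - g' x h) / norm h) \<longlongrightarrow> 0) (at 0)"
      using der[of x] by (simp add: has_derivative_at)
    ultimately have "(\<lambda>n. norm (g (x + s n *\<^sub>R e) - g x - g' x (s n *\<^sub>R e)) / norm (s n *\<^sub>R e)) \<longlonglongrightarrow> 0"
      by (rule filterlim_compose[rotated])
    from tendsto_mult[OF this tendsto_const[of "norm e"]]
    have "(\<lambda>n. norm (g (x + s n *\<^sub>R e) - g x - g' x (s n *\<^sub>R e)) / norm (s n *\<^sub>R e) * norm e) \<longlonglongrightarrow> 0"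
      by simp
    moreover have "norm (g (x + s n *\<^sub>R e) - g x - g' x (s n *\<^sub>R e)) / norm (s n *\<^sub>R e) * norm e
        = norm (q n x - g' x e)" for n
    proof -
      have "g' x (s n *\<^sub>R e) = s n *\<^sub>R g' x e"
        by (simp add: linear_simps(5)[OF has_derivative_bounded_linear[OF der]])
      then have "q n x - g' x e = (g (x + s n *\<^sub>R e) - g x - g' x (s n *\<^sub>R e)) /\<^sub>R s n"
        using s(1)[of n] by (simp add: q_def scaleR_diff_right)
      then show ?thesis
        using s(1)[of n] False by (simp add: divide_inverse)
    qed
    ultimately have "(\<lambda>n. norm (q n x - g' x e)) \<longlonglongrightarrow> 0" by simp
    then show ?thesis
      by (simp add: tendsto_norm_zero_iff LIM_zero_iff)
  qed
  have "(\<lambda>n. LINT x|lborel. q n x) \<longlonglongrightarrow> (LINT x|lborel. g' x e)"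
  proof (rule integral_dominated_convergence[where w = "\<lambda>x. B * indicator (cball 0 (R + norm e)) x"])
    show "(\<lambda>x. g' x e) \<in> borel_measurable lborel"
      using borel_measurable_continuous_onI[OF cont] by simp
    show "integrable lborel (\<lambda>x::'a. B * indicator (cball 0 (R + norm e)) x)"
      by (intro integrable_mult_right integrable_real_indicator) (use emeasure_bounded_finite[OF bounded_cball[of 0 "R + norm e"]] in auto)
  qed (use lim q_bound in auto)
  then show ?thesis by (simp add: q0 LIMSEQ_const_iff)
qed

text \<open>Integration by parts: the derivative of the compactly supported product
  \<open>\<phi> x *\<^sub>R u x\<close> integrates to zero, and both terms of the product rule are
  integrable, being continuous with compact support.\<close>

lemma is_weak_partial_if_C1:
  assumes u: "\<And>x. (u has_derivative u' x) (at x)"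
    and cont: "continuous_on UNIV (\<lambda>x. u' x e)" and e: "e \<in> Basis"
  shows "is_weak_partial e u (\<lambda>x. u' x e)"
  unfolding is_weak_partial_def
proof
  fix \<phi> assume \<phi>: "\<phi> \<in> test_functions"
  define K where "K = closure {x. \<phi> x \<noteq> 0}"
  have K: "compact K" using \<phi> by (simp add: test_functions_def K_def)
  have supp: "\<phi> x = 0" if "x \<notin> K" for x
    using that closure_subset[of "{x. \<phi> x \<noteq> 0}"] by (auto simp: K_def)
  have "C_k 1 \<phi>" using \<phi> by (simp add: test_functions_def)
  then have diff: "\<And>x. \<phi> differentiable at x"
    and cd: "continuous_on UNIV (\<lambda>x. frechet_derivative \<phi> (at x) e)"
    using e by (auto simp: differentiable_on_def)
  note d\<phi> = diff[unfolded frechet_derivative_works]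
  have cu: "continuous_on UNIV u" and c\<phi>: "continuous_on UNIV \<phi>"
    using has_derivative_continuous[OF u] has_derivative_continuous[OF d\<phi>]
    by (simp_all add: continuous_at_imp_continuous_on)
  let ?g' = "\<lambda>x h. \<phi> x *\<^sub>R u' x h + frechet_derivative \<phi> (at x) h *\<^sub>R u x"
  have "(LINT x|lborel. ?g' x e) = 0"
  proof (rule integral_directional_derivative_eq_0[where g = "\<lambda>x. \<phi> x *\<^sub>R u x" and K = K])
    show "((\<lambda>x. \<phi> x *\<^sub>R u x) has_derivative ?g' x) (at x)" for x
      by (rule has_derivative_scaleR[OF d\<phi> u])
    show "continuous_on UNIV (\<lambda>x. ?g' x e)"
      by (intro continuous_intros c\<phi> cu cd cont)
  qed (use K supp in auto)
  moreover have "integrable lborel (\<lambda>x. \<phi> x *\<^sub>R u' x e)"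
    by (rule integrable_continuous_compact_support[OF _ K])
       (use supp in \<open>auto intro!: continuous_intros c\<phi> cont\<close>)
  moreover have "integrable lborel (\<lambda>x. frechet_derivative \<phi> (at x) e *\<^sub>R u x)"
    by (rule integrable_continuous_compact_support[OF _ K])
       (use has_derivative_eq_0_outside_support[OF d\<phi> compact_imp_closed[OF K] supp]
         in \<open>auto intro!: continuous_intros cu cd\<close>)
  ultimately show "(LINT x|lborel. frechet_derivative \<phi> (at x) e *\<^sub>R u x) = - (LINT x|lborel. \<phi> x *\<^sub>R u' x e)"
    by (simp add: add_eq_0_iff)
qed

text \<open>The classical derivative witnesses that the choice in \<open>weak_partial\<close> is a
  genuine weak derivative; uniqueness then identifies the two.\<close>

lemma weak_partial_AE_if_C1:
  assumes "\<And>x. (u has_derivative u' x) (at x)" "continuous_on UNIV (\<lambda>x. u' x e)" "e \<in> Basis"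
    and "(\<lambda>x. u' x e) \<in> L2"
  shows "weak_partial e u \<in> L2" "AE x in lborel. weak_partial e u x = u' x e"
proof -
  note w = is_weak_partial_if_C1[OF assms(1-3)]
  have *: "weak_partial e u \<in> L2 \<and> is_weak_partial e u (weak_partial e u)"
    unfolding weak_partial_def by (rule someI[of _ "\<lambda>x. u' x e"]) (use assms(4) w in simp)
  then show "weak_partial e u \<in> L2" by simp
  from * show "AE x in lborel. weak_partial e u x = u' x e"
    by (intro weak_partial_unique) (use assms(4) w in auto)
qed

section \<open>Mass and moments of the radial densities\<close>

text \<open>The differentiated function is the mass enclosed by the circle of radius
  \<open>r\<close>; its derivative is the circumference times the density on the circle.\<close>

lemma DERIV_vortex_mass:
  fixes a r :: real
  assumes "a > 0" "n \<ge> 1" "r \<ge> 0"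
  shows "((\<lambda>r. r ^ (2 * n) / (r ^ (2 * n) + a)) has_real_derivative
    2 * pi * r * (a * real n / pi * (r ^ (2 * (n - 1)) / (r ^ (2 * n) + a)\<^sup>2))) (at r)"
proof -
  obtain m where n: "n = Suc m" using assms(2) by (cases n) auto
  have pos: "r ^ (2 * n) + a \<noteq> 0" using assms by (smt (verit) zero_le_power)
  have "((\<lambda>r. r ^ (2 * n) / (r ^ (2 * n) + a)) has_real_derivative
    (real (2 * n) * r ^ (2 * n - 1) * (r ^ (2 * n) + a) - r ^ (2 * n) * (real (2 * n) * r ^ (2 * n - 1)))
      / ((r ^ (2 * n) + a) * (r ^ (2 * n) + a))) (at r)"
    by (auto intro!: derivative_eq_intros pos)
  then show ?thesis
  proof (rule DERIV_cong)
    have "real (2 * n) * r ^ (2 * n - 1) * (r ^ (2 * n) + a) - r ^ (2 * n) * (real (2 * n) * r ^ (2 * n - 1))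
        = 2 * pi * r * (a * real n / pi * r ^ (2 * (n - 1)))"
      by (simp add: n field_simps)
    then show "(real (2 * n) * r ^ (2 * n - 1) * (r ^ (2 * n) + a) - r ^ (2 * n) * (real (2 * n) * r ^ (2 * n - 1)))
          / ((r ^ (2 * n) + a) * (r ^ (2 * n) + a))
        = 2 * pi * r * (a * real n / pi * (r ^ (2 * (n - 1)) / (r ^ (2 * n) + a)\<^sup>2))"
      by (simp only: power2_eq_square times_divide_eq_right)
  qed
qed

lemma vortex_mass_tendsto:
  fixes a :: real
  assumes "a > 0" "n \<ge> 1"
  shows "((\<lambda>r. r ^ (2 * n) / (r ^ (2 * n) + a)) \<longlongrightarrow> 1) at_top"
proof -
  have "filterlim (\<lambda>r::real. r ^ (2 * n)) at_top at_top"
    by (rule filterlim_pow_at_top) (use assms in \<open>auto simp: filterlim_ident\<close>)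
  then have "filterlim (\<lambda>r::real. r ^ (2 * n) + a) at_top at_top"
    by (subst add.commute) (rule filterlim_tendsto_add_at_top[OF tendsto_const])
  then have "((\<lambda>r. 1 - a / (r ^ (2 * n) + a)) \<longlongrightarrow> 1 - 0) at_top"
    by (intro tendsto_diff tendsto_const tendsto_divide_0[OF tendsto_const] filterlim_at_top_imp_at_infinity)
  then have "((\<lambda>r. 1 - a / (r ^ (2 * n) + a)) \<longlongrightarrow> 1) at_top" by simp
  then show ?thesis
  proof (rule Lim_transform_eventually)
    show "\<forall>\<^sub>F r in at_top. 1 - a / (r ^ (2 * n) + a) = r ^ (2 * n) / (r ^ (2 * n) + a)"
      using eventually_ge_at_top[of 0]
    proof eventually_elim
      case (elim r)
      then have "r ^ (2 * n) + a \<noteq> 0" using assms by (smt (verit) zero_le_power)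
      then show ?case by (simp add: field_simps)
    qed
  qed
qed

text \<open>The radial profile of |u_n|^2, with \<open>a\<close> standing for |C|^2.\<close>

definition vortex_density :: "real \<Rightarrow> nat \<Rightarrow> real \<Rightarrow> real" where
  "vortex_density a n r = a * real n / pi * (r ^ (2 * (n - 1)) / (r ^ (2 * n) + a)\<^sup>2)"

lemma vortex_density_measurable [measurable]: "vortex_density a n \<in> borel_measurable borel"
  unfolding vortex_density_def by measurable

lemma vortex_density_nonneg: "a > 0 \<Longrightarrow> vortex_density a n r \<ge> 0"
  unfolding vortex_density_def by simp

lemma has_bochner_integral_vortex_density:
  assumes "a > 0" "n \<ge> 1"
  shows "has_bochner_integral lborel (\<lambda>z::complex. vortex_density a n (cmod z)) 1"
proof (rule has_bochner_integral_nn_integral)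
  have "(\<integral>\<^sup>+z. ennreal (vortex_density a n (cmod z)) \<partial>lborel)
      = (\<integral>\<^sup>+r. ennreal (2 * pi * r * vortex_density a n r) * indicator {0..} r \<partial>lborel)"
    by (subst nn_integral_radial)
       (auto simp: indicator_def ennreal_mult' intro!: nn_integral_cong)
  also have "\<dots> = ennreal (1 - 0 ^ (2 * n) / (0 ^ (2 * n) + a))"
    by (rule nn_integral_FTC_atLeast[OF _ _ _ vortex_mass_tendsto[OF assms]])
       (use assms vortex_density_nonneg[OF assms(1)] DERIV_vortex_mass[OF assms]
         in \<open>auto simp: vortex_density_def\<close>)
  finally show "(\<integral>\<^sup>+z. ennreal (vortex_density a n (cmod z)) \<partial>lborel) = ennreal 1"
    using assms by simp
qed (use vortex_density_nonneg[OF assms(1)] in auto)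

lemma vortex_mass_in_ball:
  assumes "a > 0" "n \<ge> 1" "R \<ge> 0"
  shows "(LINT z|lborel. indicator {..<R} (cmod z) * vortex_density a n (cmod z)) = R ^ (2 * n) / (R ^ (2 * n) + a)"
proof (rule integral_eq_nn_integral[THEN trans])
  have "(\<integral>\<^sup>+z. ennreal (indicator {..<R} (cmod z) * vortex_density a n (cmod z)) \<partial>lborel)
      = (\<integral>\<^sup>+r. ennreal (2 * pi * r) * ennreal (indicator {..<R} r * vortex_density a n r) * indicator {0..} r \<partial>lborel)"
    by (rule nn_integral_radial) measurable
  also have "\<dots> = (\<integral>\<^sup>+r. ennreal (2 * pi * r * vortex_density a n r) * indicator {0..R} r \<partial>lborel)"
    using AE_lborel_singleton[of R]
    by (intro nn_integral_cong_AE) (auto simp: indicator_def ennreal_mult')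
  also have "\<dots> = ennreal (R ^ (2 * n) / (R ^ (2 * n) + a) - 0 ^ (2 * n) / (0 ^ (2 * n) + a))"
    by (rule nn_integral_FTC_Icc)
       (use assms vortex_density_nonneg[OF assms(1)] DERIV_vortex_mass[OF assms(1,2)]
         in \<open>auto simp: vortex_density_def\<close>)
  also have "R ^ (2 * n) / (R ^ (2 * n) + a) - 0 ^ (2 * n) / (0 ^ (2 * n) + a) = R ^ (2 * n) / (R ^ (2 * n) + a)"
    using assms by simp
  finally show "enn2real (\<integral>\<^sup>+z. ennreal (indicator {..<R} (cmod z) * vortex_density a n (cmod z)) \<partial>lborel)
    = R ^ (2 * n) / (R ^ (2 * n) + a)"
    using assms by (simp only:) (rule enn2real_ennreal, simp)
qed (use vortex_density_nonneg[OF assms(1)] in auto)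

section \<open>Moments of the fourth inverse power of the denominator\<close>

definition vortex_moment :: "real \<Rightarrow> nat \<Rightarrow> nat \<Rightarrow> real" where
  "vortex_moment a n p = (LINT z::complex|lborel. cmod z ^ p / (cmod z ^ (2 * n) + a) ^ 4)"

text \<open>The condition on \<open>p\<close> says that the integrand decays at least like r^(-4).
  The majorant is a multiple of 1 / (1 + r^2)^2, which is pi times the density for
  \<open>n = 1\<close>, \<open>a = 1\<close> and so has a known integral.\<close>

lemma integrable_vortex_moment:
  assumes a: "a > 0" and p: "p + 4 \<le> 8 * n"
  shows "integrable lborel (\<lambda>z::complex. cmod z ^ p / (cmod z ^ (2 * n) + a) ^ 4)"
proof (rule Bochner_Integration.integrable_bound)
  have "integrable lborel (\<lambda>z::complex. vortex_density 1 1 (cmod z))"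
    using has_bochner_integral_vortex_density[of 1 1] by (simp add: has_bochner_integral_iff)
  then show "integrable lborel (\<lambda>z::complex. (4 / a ^ 4 + 4) * (pi * vortex_density 1 1 (cmod z)))"
    by (intro integrable_mult_right)
  show "AE z in lborel. norm (cmod z ^ p / (cmod z ^ (2 * n) + a) ^ 4)
      \<le> norm ((4 / a ^ 4 + 4) * (pi * vortex_density 1 1 (cmod z)))"
  proof (rule AE_I2)
    fix z :: complex
    define r where "r = cmod z"
    have r: "r \<ge> 0" by (simp add: r_def)
    have D: "r ^ (2 * n) + a > 0" using r a by (simp add: add_nonneg_pos)
    have pos: "1 + r\<^sup>2 \<noteq> 0"
      by (metis add_pos_nonneg less_irrefl zero_le_power2 zero_less_one)
    \<comment> \<open>The two constants serve two ranges: for r \<le> 1, (1 + r^2)^2 \<le> 4 and the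
      denominator is at least a^4; for r > 1, 1 + r^2 \<le> 2 r^2 and r^(p + 4) \<le> r^(8
      n).\<close>
    have "r ^ p / (r ^ (2 * n) + a) ^ 4 \<le> (4 / a ^ 4 + 4) / (1 + r\<^sup>2)\<^sup>2"
    proof (cases "r \<le> 1")
      case True
      have "r ^ p * (1 + r\<^sup>2)\<^sup>2 \<le> 1 * (1 + 1)\<^sup>2"
        using r True by (intro mult_mono power_mono add_left_mono) (auto simp: power_le_one)
      moreover have "a ^ 4 \<le> (r ^ (2 * n) + a) ^ 4"
        using a r by (intro power_mono) auto
      ultimately have "r ^ p * (1 + r\<^sup>2)\<^sup>2 / (r ^ (2 * n) + a) ^ 4 \<le> 4 / a ^ 4"
        using a r by (intro frac_le) auto
      also have "\<dots> \<le> 4 / a ^ 4 + 4" by simp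
      finally show ?thesis
        using pos by (subst pos_le_divide_eq) simp_all
    next
      case False
      have "r ^ p * (1 + r\<^sup>2)\<^sup>2 \<le> r ^ p * (2 * r\<^sup>2)\<^sup>2"
        using False by (intro mult_left_mono power_mono) (auto simp: one_le_power)
      also have "\<dots> = 4 * r ^ (p + 4)" by (simp add: power_mult_distrib power_add flip: power_mult)
      also have "\<dots> \<le> 4 * r ^ (8 * n)"
        using False p by (intro mult_left_mono power_increasing) auto
      also have "r ^ (8 * n) = (r ^ (2 * n)) ^ 4" by (simp flip: power_mult)
      also have "4 * \<dots> \<le> 4 * (r ^ (2 * n) + a) ^ 4"
        using a r by (intro mult_left_mono power_mono) auto
      finally have "r ^ p * (1 + r\<^sup>2)\<^sup>2 / (r ^ (2 * n) + a) ^ 4 \<le> 4"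
        using D by (simp add: pos_divide_le_eq)
      also have "\<dots> \<le> 4 / a ^ 4 + 4" using a by simp
      finally show ?thesis
        using pos by (subst pos_le_divide_eq) simp_all
    qed
    also have "\<dots> = (4 / a ^ 4 + 4) * (pi * vortex_density 1 1 r)"
      by (simp add: vortex_density_def add.commute[of 1] power2_eq_square)
    finally show "norm (cmod z ^ p / (cmod z ^ (2 * n) + a) ^ 4)
        \<le> norm ((4 / a ^ 4 + 4) * (pi * vortex_density 1 1 (cmod z)))"
      by (simp add: r_def)
  qed
qed measurable

text \<open>Both boundary terms vanish. The indicator includes 0 to match the radial integral
  formula, whereas the derivative is known only for \<open>r > 0\<close>; the endpoint is
  null.\<close>

lemma integral_half_line_derivative_eq_0:
  fixes f F :: "real \<Rightarrow> real"
  assumes F: "\<And>r. r > 0 \<Longrightarrow> (F has_real_derivative f r) (at r)"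
    and cont: "\<And>r. r > 0 \<Longrightarrow> isCont f r"
    and int: "integrable lborel (\<lambda>r. indicator {0..} r * f r)"
    and lim: "(F \<longlongrightarrow> 0) (at_right 0)" "(F \<longlongrightarrow> 0) at_top"
  shows "(LINT r|lborel. indicator {0..} r * f r) = 0"
proof -
  have ae: "AE r in lborel. indicator {0..} r * f r = indicator {0<..} r * f r"
    using AE_lborel_singleton[of 0] by eventually_elim (auto simp: indicator_def)
  have m: "(\<lambda>r. indicator {0<..} r * f r) \<in> borel_measurable lborel"
  proof -
    have "continuous_on {0<..} f"
      by (intro continuous_at_imp_continuous_on) (use cont in auto)
    from borel_measurable_continuous_on_indicator[OF _ this] show ?thesis by simp
  qed
  have "(LBINT r=0..\<infinity>. f r) = 0 - 0"
  proof (rule interval_integral_FTC_integrable)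
    have "integrable lborel (\<lambda>r. indicator {0<..} r * f r)"
      by (rule integrable_cong_AE_imp[OF int m]) (use ae in auto)
    then show "set_integrable lborel (einterval 0 \<infinity>) f"
      unfolding set_integrable_def zero_ereal_def by simp
    show "((F \<circ> real_of_ereal) \<longlongrightarrow> 0) (at_right 0)"
      using lim by (simp add: ereal_tendsto_simps zero_ereal_def)
    show "((F \<circ> real_of_ereal) \<longlongrightarrow> 0) (at_left \<infinity>)"
      using lim by (simp add: ereal_tendsto_simps)
  qed (use F cont in \<open>auto simp: has_real_derivative_iff_has_vector_derivative\<close>)
  then have "(LINT r|lborel. indicator {0<..} r * f r) = 0"
    by (simp add: interval_lebesgue_integral_0_infty set_lebesgue_integral_def)
  then show ?thesis
    using integral_cong_AE[OF _ m ae] int by auto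
qed

text \<open>The derivative of 2 pi r^k / D^3 is 2 pi r h(r), with \<open>h\<close> the difference of
  the two integrands. The lower bound on \<open>k\<close> makes r^k / D^3 vanish at 0 and
  \<open>k - 2\<close> a true difference; the upper bound gives integrability of the higher moment
  and decay at infinity.\<close>

lemma vortex_moment_recurrence:
  assumes a: "a > 0" and k: "2 \<le> k" "k + 2 \<le> 6 * n"
  shows "real k * a * vortex_moment a n (k - 2) = (6 * real n - real k) * vortex_moment a n (k - 2 + 2 * n)"
proof -
  have n: "n \<ge> 1" using k by simp
  obtain j where j: "k = Suc (Suc j)" using k by (metis Suc_le_D numeral_2_eq_2 Suc_le_mono)
  have p0: "k - 2 = j" by (simp add: j)
  define D where "D r = r ^ (2 * n) + a" for r :: real
  have D: "D r > 0" for r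
    using a by (simp add: D_def add_nonneg_pos)
  define h where "h r = real k * a * (r ^ j / D r ^ 4)
      - (6 * real n - real k) * (r ^ (j + 2 * n) / D r ^ 4)" for r
  have i1: "integrable lborel (\<lambda>z::complex. cmod z ^ j / D (cmod z) ^ 4)"
    unfolding D_def by (rule integrable_vortex_moment) (use a j k in auto)
  have i2: "integrable lborel (\<lambda>z::complex. cmod z ^ (j + 2 * n) / D (cmod z) ^ 4)"
    unfolding D_def by (rule integrable_vortex_moment) (use a j k in auto)
  have hm[measurable]: "h \<in> borel_measurable borel" unfolding h_def D_def by measurable
  have hi: "integrable lborel (\<lambda>z::complex. h (cmod z))"
    unfolding h_def by (intro Bochner_Integration.integrable_diff integrable_mult_right i1 i2)
  have "(LINT z::complex|lborel. h (cmod z)) = real k * a * vortex_moment a n j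
      - (6 * real n - real k) * vortex_moment a n (j + 2 * n)"
    unfolding h_def vortex_moment_def D_def[symmetric]
    by (subst Bochner_Integration.integral_diff)
       (auto intro!: integrable_mult_right i1 i2 simp del: times_divide_eq_right)
  moreover have "(LINT z::complex|lborel. h (cmod z)) = (LINT r|lborel. indicator {0..} r * (2 * pi * r * h r))"
    by (rule integral_radial) measurable
  moreover have "(LINT r|lborel. indicator {0..} r * (2 * pi * r * h r)) = 0"
  proof (rule integral_half_line_derivative_eq_0[where F = "\<lambda>r. 2 * pi * (r ^ k / D r ^ 3)"])
    fix r :: real assume "r > 0"
    obtain m where m: "n = Suc m" using n by (cases n) auto
    have dD: "(D has_real_derivative real (2 * n) * r ^ (2 * n - 1)) (at r)"
      unfolding D_def by (auto intro!: derivative_eq_intros)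
    have "((\<lambda>r. 2 * pi * (r ^ k / D r ^ 3)) has_real_derivative
        2 * pi * ((real k * r ^ (k - 1) * D r ^ 3 - r ^ k * (3 * D r ^ 2 * (real (2 * n) * r ^ (2 * n - 1))))
          / (D r ^ 3 * D r ^ 3))) (at r)"
      using D[of r] by (auto intro!: derivative_eq_intros dD simp: algebra_simps)
    also have "(real k * r ^ (k - 1) * D r ^ 3 - r ^ k * (3 * D r ^ 2 * (real (2 * n) * r ^ (2 * n - 1))))
          / (D r ^ 3 * D r ^ 3) = (real k * r ^ (k - 1) * D r - r ^ k * (6 * real n * r ^ (2 * n - 1))) / D r ^ 4"
      using D[of r] by (simp add: field_simps power_numeral_reduce)
    also have "real k * r ^ (k - 1) * D r - r ^ k * (6 * real n * r ^ (2 * n - 1))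
        = r * (real k * a * r ^ j - (6 * real n - real k) * r ^ (j + 2 * n))"
      by (simp add: D_def j m algebra_simps power_add)
    also have "2 * pi * (\<dots> / D r ^ 4) = 2 * pi * r * h r"
      by (simp add: h_def diff_divide_distrib right_diff_distrib mult_ac)
    finally show "((\<lambda>r. 2 * pi * (r ^ k / D r ^ 3)) has_real_derivative 2 * pi * r * h r) (at r)" .
    show "isCont (\<lambda>r. 2 * pi * r * h r) r"
      unfolding h_def using D less_imp_neq[OF D, symmetric]
      by (auto intro!: continuous_intros simp: D_def)
  next
    show "integrable lborel (\<lambda>r. indicator {0..} r * (2 * pi * r * h r))"
      using hi by (simp add: integral_radial(2))
  next
    have "((\<lambda>r. 2 * pi * (r ^ k / D r ^ 3)) \<longlongrightarrow> 2 * pi * (0 ^ k / D 0 ^ 3)) (at_right 0)"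
      using less_imp_neq[OF D, symmetric] by (auto intro!: tendsto_intros simp: D_def)
    then show "((\<lambda>r. 2 * pi * (r ^ k / D r ^ 3)) \<longlongrightarrow> 0) (at_right 0)"
      using k by (simp add: power_0_left)
  next
    show "((\<lambda>r. 2 * pi * (r ^ k / D r ^ 3)) \<longlongrightarrow> 0) at_top"
    proof (rule tendsto_sandwich[OF _ _ tendsto_const])
      show "\<forall>\<^sub>F r in at_top. 0 \<le> 2 * pi * (r ^ k / D r ^ 3)"
        using eventually_ge_at_top[of 0] by eventually_elim (use D in \<open>simp add: less_imp_le\<close>)
      show "\<forall>\<^sub>F r in at_top. 2 * pi * (r ^ k / D r ^ 3) \<le> 2 * pi * (1 / r)"
        using eventually_ge_at_top[of 1]
      proof eventually_elim
        case (elim r)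
        have "r ^ Suc k \<le> r ^ (6 * n)" using elim k by (intro power_increasing) auto
        also have "\<dots> = (r ^ (2 * n)) ^ 3" by (simp flip: power_mult)
        also have "\<dots> \<le> D r ^ 3" unfolding D_def using elim a by (intro power_mono) auto
        finally have "r ^ k / D r ^ 3 \<le> 1 / r" using elim D[of r] by (simp add: field_simps)
        then have "2 * pi * (r ^ k / D r ^ 3) \<le> 2 * pi * (1 / r)"
          by (rule mult_left_mono) simp
        then show ?case .
      qed
      have "((\<lambda>r::real. 2 * pi * (1 / r)) \<longlongrightarrow> 2 * pi * 0) at_top"
        by (intro tendsto_intros tendsto_divide_0[OF tendsto_const] filterlim_at_top_imp_at_infinity filterlim_ident)
      then show "((\<lambda>r::real. 2 * pi * (1 / r)) \<longlongrightarrow> 0) at_top" by simp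
    qed
  qed
  ultimately show ?thesis by (simp add: p0)
qed

text \<open>Allows division by the quartic integral. The integrand vanishes at most at the origin,
  so a zero integral would make the whole plane a null set.\<close>

lemma vortex_moment_pos:
  assumes "a > 0" "p + 4 \<le> 8 * n"
  shows "vortex_moment a n p > 0"
proof -
  have "vortex_moment a n p \<ge> 0"
    unfolding vortex_moment_def using assms by (intro integral_nonneg_AE) auto
  moreover have "vortex_moment a n p \<noteq> 0"
  proof
    assume "vortex_moment a n p = 0"
    then have "AE z::complex in lborel. cmod z ^ p / (cmod z ^ (2 * n) + a) ^ 4 = 0"
      unfolding vortex_moment_def
      by (subst (asm) integral_nonneg_eq_0_iff_AE[OF integrable_vortex_moment[OF assms]]) auto
    with AE_lborel_singleton[of "0::complex"] have "AE z::complex in lborel. False"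
    proof eventually_elim
      case (elim z)
      moreover have "cmod z ^ (2 * n) + a > 0"
        using assms by (simp add: add_nonneg_pos)
      ultimately show ?case by simp
    qed
    then have "emeasure lborel (UNIV :: complex set) = 0"
      by (subst (asm) AE_iff_measurable[of UNIV]) auto
    then show False by simp
  qed
  ultimately show ?thesis by simp
qed

section \<open>The covariant gradient of the solitons\<close>

text \<open>Product rule for \<open>cnj z ^ m\<close> and the inverse denominator, with n = m + 1.
  For \<open>m = 0\<close> the truncated exponent \<open>m - 1\<close> is harmless, as its
  coefficient is 0.\<close>

definition soliton_deriv :: "complex \<Rightarrow> nat \<Rightarrow> complex \<Rightarrow> complex \<Rightarrow> complex" where
  "soliton_deriv C m z h = cnj C * of_real (sqrt (real (Suc m) / pi)) *
     (of_nat m * cnj z ^ (m - 1) * cnj h / of_real (cmod z ^ (2 * Suc m) + (cmod C)\<^sup>2)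
      - cnj z ^ m * of_real (2 * real (Suc m) * cmod z ^ (2 * m) * (z \<bullet> h))
        / of_real ((cmod z ^ (2 * Suc m) + (cmod C)\<^sup>2)\<^sup>2))"

lemma soliton_denominator_pos: "C \<noteq> 0 \<Longrightarrow> cmod z ^ k + (cmod C)\<^sup>2 > 0"
  by (simp add: add_nonneg_pos)

text \<open>Written with the inner product, even powers of the modulus are polynomial and so
  differentiable at the origin too, where \<open>cmod\<close> itself is not.\<close>

lemma cmod_even_power: "cmod z ^ (2 * k) = (z \<bullet> z) ^ k"
  by (simp add: power_mult power2_norm_eq_inner)

lemma has_derivative_soliton:
  assumes "C \<noteq> 0"
  shows "(soliton C (Suc m) has_derivative soliton_deriv C m z) (at z)"
proof -
  define E where "E = (\<lambda>z::complex. (z \<bullet> z) ^ Suc m + (cmod C)\<^sup>2)"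
  define \<kappa> where "\<kappa> = cnj C * of_real (sqrt (real (Suc m) / pi))"
  have E: "cmod w ^ (2 * Suc m) + (cmod C)\<^sup>2 = E w" for w
    by (simp only: E_def cmod_even_power)
  have pos: "E z \<noteq> 0"
    using soliton_denominator_pos[OF assms, of z "2 * Suc m"] unfolding E by simp
  have dE: "(E has_derivative (\<lambda>h. 2 * real (Suc m) * cmod z ^ (2 * m) * (z \<bullet> h))) (at z)"
  proof -
    have "((\<lambda>z. z \<bullet> z) has_derivative (\<lambda>h. 2 * (z \<bullet> h))) (at z)"
      by (auto intro!: derivative_eq_intros simp: inner_commute)
    from has_derivative_add[OF has_derivative_power[OF this, of "Suc m"] has_derivative_const[of "(cmod C)\<^sup>2"]]
    show ?thesis
      unfolding E_def cmod_even_power by (rule has_derivative_eq_rhs) (simp add: mult_ac del: of_nat_Suc)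
  qed
  have dP: "((\<lambda>z. cnj z ^ m) has_derivative (\<lambda>h. of_nat m * cnj h * cnj z ^ (m - 1))) (at z)"
    by (auto intro!: derivative_eq_intros bounded_linear_cnj[THEN bounded_linear.has_derivative])
  have "((\<lambda>z. \<kappa> * (cnj z ^ m * of_real (inverse (E z)))) has_derivative soliton_deriv C m z) (at z)"
  proof (rule has_derivative_eq_rhs[OF has_derivative_mult_right[OF
        has_derivative_mult[OF dP has_derivative_of_real[OF Deriv.has_derivative_inverse[OF pos dE]]]]])
    show "(\<lambda>h. \<kappa> * (cnj z ^ m * of_real (- (inverse (E z) * (2 * real (Suc m) * cmod z ^ (2 * m) * (z \<bullet> h)) * inverse (E z)))
        + of_nat m * cnj h * cnj z ^ (m - 1) * of_real (inverse (E z)))) = soliton_deriv C m z"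
      unfolding soliton_deriv_def E \<kappa>_def[symmetric]
      by (rule ext) (simp add: divide_inverse power2_eq_square algebra_simps del: of_nat_Suc)
  qed
  moreover have "soliton C (Suc m) = (\<lambda>z. \<kappa> * (cnj z ^ m * of_real (inverse (E z))))"
    unfolding soliton_def E \<kappa>_def[symmetric] by (rule ext) (simp add: divide_inverse)
  ultimately show ?thesis by simp
qed

lemma continuous_soliton_deriv:
  assumes "C \<noteq> 0"
  shows "continuous_on UNIV (\<lambda>z. soliton_deriv C m z h)"
  unfolding soliton_deriv_def
  using soliton_denominator_pos[OF assms]
  by (intro continuous_intros) (simp_all only: of_real_eq_0_iff power_eq_0_iff less_irrefl, (metis less_irrefl)+)

lemma cmod_soliton_power2:
  assumes "C \<noteq> 0"
  shows "(cmod (soliton C (Suc m) z))\<^sup>2 = vortex_density ((cmod C)\<^sup>2) (Suc m) (cmod z)"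
  using soliton_denominator_pos[OF assms, of z "2 * Suc m"]
  by (simp add: soliton_def vortex_density_def norm_mult norm_divide norm_power power_mult_distrib
      power_divide power_mult[symmetric] mult.commute[of m] del: power_Suc of_real_add of_real_power)

text \<open>For \<open>m = 0\<close> the exponent \<open>2 * m - 2\<close> is truncated to \<open>0\<close>; this is harmless because its
  coefficient vanishes.\<close>

definition energy_density :: "real \<Rightarrow> nat \<Rightarrow> real \<Rightarrow> real \<Rightarrow> real" where
  "energy_density a m \<beta> r = a * real (Suc m) / pi *
     (2 * (real m)\<^sup>2 * a\<^sup>2 * (r ^ (2 * m - 2) / (r ^ (2 * Suc m) + a) ^ 4)
      - 2 * real m * (2 + \<beta>) * a * (r ^ (4 * m) / (r ^ (2 * Suc m) + a) ^ 4)
      + ((real m + 2)\<^sup>2 + (real m - \<beta>)\<^sup>2) * (r ^ (6 * m + 2) / (r ^ (2 * Suc m) + a) ^ 4))"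

text \<open>Extracts a factor common to both directions, so that only a simple bracket remains to be
  squared. Here \<open>q\<close> stands for the component of \<open>perp z\<close> along
  \<open>h\<close>: \<open>- Im z\<close> for \<open>h = 1\<close> and \<open>Re z\<close> for
  \<open>h = \<i>\<close>.\<close>

lemma soliton_covariant_derivative:
  fixes m :: nat
  assumes C: "C \<noteq> 0" and z: "z \<noteq> 0"
  defines "D \<equiv> cmod z ^ (2 * Suc m) + (cmod C)\<^sup>2" and "t \<equiv> cmod z ^ (2 * Suc m)"
  shows "soliton_deriv C m z h + \<i> * of_real (\<beta> * (t / D / (cmod z)\<^sup>2 * q)) * soliton C (Suc m) z
    = cnj C * of_real (sqrt (real (Suc m) / pi)) * cnj z ^ m / of_real (D\<^sup>2 * (cmod z)\<^sup>2) *
      (of_real (real m * D) * z * cnj h - of_real (2 * real (Suc m) * t * (z \<bullet> h)) + \<i> * of_real (\<beta> * t * q))"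
proof -
  have D: "D \<noteq> 0" using soliton_denominator_pos[OF C, of z "2 * Suc m"] by (simp add: D_def)
  define \<rho> where "\<rho> = (cmod z)\<^sup>2"
  have \<rho>: "\<rho> \<noteq> 0" using z by (simp add: \<rho>_def)
  have \<rho>z: "complex_of_real \<rho> = z * cnj z" by (simp only: \<rho>_def complex_norm_square)
  define s where "s = cmod z ^ (2 * m)"
  have t: "t = s * \<rho>" by (simp add: t_def \<rho>_def s_def power_add[symmetric])
  \<comment> \<open>Multiplying by |z|^2 = z cnj z raises the exponent from \<open>m - 1\<close> to
    \<open>m\<close>; for \<open>m = 0\<close> both sides are 0.\<close>
  have pm: "of_nat m * cnj z ^ (m - 1) * of_real \<rho> = of_nat m * cnj z ^ m * z"
    by (cases m) (simp_all add: \<rho>z)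
  have 1: "of_nat m * cnj z ^ (m - 1) * cnj h / of_real D
      = of_real (real m * D) * z * cnj h * cnj z ^ m / of_real (D\<^sup>2 * \<rho>)"
  proof -
    have "of_nat m * cnj z ^ (m - 1) * cnj h / of_real D
      = (of_nat m * cnj z ^ (m - 1) * of_real \<rho>) * cnj h / (of_real D * of_real \<rho>)"
      using \<rho> by simp
    also have "\<dots> = of_real (real m * D) * z * cnj h * cnj z ^ m / of_real (D\<^sup>2 * \<rho>)"
      unfolding pm using D \<rho> by (simp add: power2_eq_square)
    finally show ?thesis .
  qed
  have 2: "cnj z ^ m * of_real (2 * real (Suc m) * s * (z \<bullet> h)) / of_real (D\<^sup>2)
      = of_real (2 * real (Suc m) * t * (z \<bullet> h)) * cnj z ^ m / of_real (D\<^sup>2 * \<rho>)"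
    using \<rho> by (simp add: t del: of_nat_Suc)
  have 3: "\<i> * of_real (\<beta> * (t / D / \<rho> * q)) * (\<kappa> * (cnj z ^ m / of_real D))
      = \<kappa> * (\<i> * of_real (\<beta> * t * q) * cnj z ^ m / of_real (D\<^sup>2 * \<rho>))" for \<kappa>
    using D \<rho> by (simp add: power2_eq_square mult_ac)
  show ?thesis
    unfolding soliton_deriv_def soliton_def D_def[symmetric] s_def[symmetric] \<rho>_def[symmetric] diff_Suc_1 3
    unfolding 1 2 by (simp add: algebra_simps add_divide_distrib diff_divide_distrib del: of_nat_Suc of_real_mult of_real_power)
qed

text \<open>In each direction the bracket has real part \<open>real m * D - 2 * n * t\<close> and
  imaginary part \<open>real m * D - \<beta> * t\<close>, up to sign, times a coordinate of
  \<open>z\<close>. The coordinates swap between the directions, so the sum of squares is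
  radial.\<close>

lemma soliton_covariant_gradient_norm:
  fixes m :: nat
  assumes C: "C \<noteq> 0" and z: "z \<noteq> 0"
  defines "M \<equiv> cmod z ^ (2 * Suc m) / (cmod z ^ (2 * Suc m) + (cmod C)\<^sup>2)"
  shows "(cmod (soliton_deriv C m z 1 + \<i> * of_real (\<beta> * (M / (cmod z)\<^sup>2 * - Im z)) * soliton C (Suc m) z))\<^sup>2
    + (cmod (soliton_deriv C m z \<i> + \<i> * of_real (\<beta> * (M / (cmod z)\<^sup>2 * Re z)) * soliton C (Suc m) z))\<^sup>2
    = energy_density ((cmod C)\<^sup>2) m \<beta> (cmod z)"
proof -
  define a where "a = (cmod C)\<^sup>2"
  define r where "r = cmod z"
  define t where "t = r ^ (2 * Suc m)"
  define D where "D = t + a"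
  define n where "n = real (Suc m)"
  define p where "p = cnj C * of_real (sqrt (real (Suc m) / pi)) * cnj z ^ m / of_real (D\<^sup>2 * r\<^sup>2)"
  have r: "r > 0" using z by (simp add: r_def)
  have D: "D > 0" using soliton_denominator_pos[OF C, of z "2 * Suc m"] by (simp add: D_def a_def t_def r_def)
  have r2: "(Re z)\<^sup>2 + (Im z)\<^sup>2 = r\<^sup>2" by (simp add: r_def cmod_power2)
  have p: "(cmod p)\<^sup>2 = a * n / pi * (r ^ (2 * m) / (D ^ 4 * r ^ 4))"
    using D r by (simp add: p_def norm_mult norm_divide norm_power power_mult_distrib power_divide
        a_def n_def r_def[symmetric] power_mult[symmetric] mult.commute[of m] del: of_real_mult of_real_power of_nat_Suc)
  note cov = soliton_covariant_derivative[OF C z, of m _ \<beta>, folded M_def, folded a_def r_def, folded t_def, folded D_def,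
      folded p_def, folded n_def]
  have A: "(cmod (of_real (real m * D) * z * cnj 1 - of_real (2 * n * t * (z \<bullet> 1)) + \<i> * of_real (\<beta> * t * - Im z)))\<^sup>2
    = ((real m * D - 2 * n * t) * Re z)\<^sup>2 + ((real m * D - \<beta> * t) * Im z)\<^sup>2"
    by (simp add: cmod_power2 inner_complex_def algebra_simps)
  have B: "(cmod (of_real (real m * D) * z * cnj \<i> - of_real (2 * n * t * (z \<bullet> \<i>)) + \<i> * of_real (\<beta> * t * Re z)))\<^sup>2
    = ((real m * D - 2 * n * t) * Im z)\<^sup>2 + ((real m * D - \<beta> * t) * Re z)\<^sup>2"
    unfolding cmod_power2 by (simp add: inner_complex_def algebra_simps power2_eq_square)
  have "(cmod (soliton_deriv C m z 1 + \<i> * of_real (\<beta> * (M / (cmod z)\<^sup>2 * - Im z)) * soliton C (Suc m) z))\<^sup>2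
    + (cmod (soliton_deriv C m z \<i> + \<i> * of_real (\<beta> * (M / (cmod z)\<^sup>2 * Re z)) * soliton C (Suc m) z))\<^sup>2
    = (cmod p)\<^sup>2 * (((real m * D - 2 * n * t) * Re z)\<^sup>2 + ((real m * D - \<beta> * t) * Im z)\<^sup>2)
    + (cmod p)\<^sup>2 * (((real m * D - 2 * n * t) * Im z)\<^sup>2 + ((real m * D - \<beta> * t) * Re z)\<^sup>2)"
    unfolding r_def[symmetric] cov norm_mult power_mult_distrib A[unfolded power_mult_distrib] B[unfolded power_mult_distrib] by simp
  also have "\<dots> = (cmod p)\<^sup>2 * (((Re z)\<^sup>2 + (Im z)\<^sup>2) * ((real m * D - 2 * n * t)\<^sup>2 + (real m * D - \<beta> * t)\<^sup>2))"
    by (simp only: power_mult_distrib distrib_left distrib_right add_ac mult_ac)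
  also have "\<dots> = a * n / pi * (r ^ (2 * m) / r\<^sup>2 * ((real m * D - 2 * n * t)\<^sup>2 + (real m * D - \<beta> * t)\<^sup>2) / D ^ 4)"
    unfolding r2 p using r D by (simp add: field_simps power_numeral_reduce)
  \<comment> \<open>As D = t + a and n = m + 1, the brackets are m a - (m + 2) t and m a + (m -
    \<beta>) t. Their squares yield the coefficients in \<open>energy_density\<close>.\<close>
  also have "(real m * D - 2 * n * t)\<^sup>2 + (real m * D - \<beta> * t)\<^sup>2
      = 2 * a\<^sup>2 * (real m)\<^sup>2 - 2 * real m * (2 + \<beta>) * a * t + ((real m + 2)\<^sup>2 + (real m - \<beta>)\<^sup>2) * t\<^sup>2"
    by (simp add: D_def n_def power2_eq_square algebra_simps)
  also have "r ^ (2 * m) / r\<^sup>2 * \<dots>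
      = 2 * a\<^sup>2 * ((real m)\<^sup>2 * (r ^ (2 * m) / r\<^sup>2)) - 2 * real m * (2 + \<beta>) * a * (r ^ (2 * m) / r\<^sup>2 * t)
        + ((real m + 2)\<^sup>2 + (real m - \<beta>)\<^sup>2) * (r ^ (2 * m) / r\<^sup>2 * t\<^sup>2)"
    by (simp add: algebra_simps add_divide_distrib)
  \<comment> \<open>The factor \<open>(real m)\<^sup>2\<close> must stay: for \<open>m = 0\<close>
    the quotient is 1 / r^2, while the truncated exponent gives 1.\<close>
  also have "(real m)\<^sup>2 * (r ^ (2 * m) / r\<^sup>2) = (real m)\<^sup>2 * r ^ (2 * m - 2)"
    using r by (cases m) (simp_all add: power2_eq_square)
  also have "r ^ (2 * m) / r\<^sup>2 * t = r ^ (4 * m)"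
    using r by (simp add: t_def power2_eq_square flip: power_add)
  also have "r ^ (2 * m) / r\<^sup>2 * t\<^sup>2 = r ^ (6 * m + 2)"
    using r by (simp add: t_def field_simps flip: power_add power_mult)
  finally show ?thesis
    unfolding energy_density_def a_def[symmetric] r_def[symmetric] t_def[symmetric] D_def[symmetric] n_def[symmetric]
    by (simp add: add_divide_distrib diff_divide_distrib mult_ac)
qed

section \<open>Energies of the solitons\<close>

text \<open>The substitution \<open>s = r\<^sup>2\<close> also covers negative \<open>r\<close>,
  since the bound on the profile is required on the whole real line.\<close>

lemma vortex_density_bounded:
  assumes "a > 0"
  shows "\<bar>vortex_density a (Suc m) r\<bar> \<le> a * real (Suc m) / pi * (1 / a\<^sup>2 + 1)"
proof -
  define s where "s = r\<^sup>2"
  have s: "s \<ge> 0" by (simp add: s_def)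
  have "s ^ m / (s ^ Suc m + a)\<^sup>2 \<le> 1 / a\<^sup>2 + 1"
  proof (cases "s \<le> 1")
    case True
    have "s ^ m / (s ^ Suc m + a)\<^sup>2 \<le> 1 / a\<^sup>2"
      using s True assms by (intro frac_le power_mono) (auto simp: power_le_one)
    then show ?thesis by simp
  next
    case False
    have "s ^ m \<le> s ^ (Suc m * 2)" using False by (intro power_increasing) auto
    also have "\<dots> = (s ^ Suc m)\<^sup>2" by (rule power_mult)
    also have "\<dots> \<le> (s ^ Suc m + a)\<^sup>2" using s assms by (intro power_mono) auto
    finally have "s ^ m / (s ^ Suc m + a)\<^sup>2 \<le> 1"
      using s assms by (intro divide_le_eq_1[THEN iffD2]) auto
    then show ?thesis by (simp add: add_increasing)
  qed
  then have "a * real (Suc m) / pi * (s ^ m / (s ^ Suc m + a)\<^sup>2) \<le> a * real (Suc m) / pi * (1 / a\<^sup>2 + 1)"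
    using assms by (intro mult_left_mono) auto
  moreover have "vortex_density a (Suc m) r = a * real (Suc m) / pi * (s ^ m / (s ^ Suc m + a)\<^sup>2)"
    unfolding vortex_density_def s_def power_mult by simp
  ultimately show ?thesis using vortex_density_nonneg[OF assms, of "Suc m" r] by simp
qed

lemma gauge_potential_soliton:
  assumes "C \<noteq> 0" "z \<noteq> 0"
  shows "gauge_potential (\<lambda>y. (cmod (soliton C (Suc m) y))\<^sup>2) z =
    (cmod z ^ (2 * Suc m) / (cmod z ^ (2 * Suc m) + (cmod C)\<^sup>2) / (cmod z)\<^sup>2) *\<^sub>R perp z"
proof -
  have a: "(cmod C)\<^sup>2 > 0" using assms by simp
  note hbi = has_bochner_integral_vortex_density[OF a, of "Suc m", unfolded has_bochner_integral_iff]
  have "gauge_potential (\<lambda>y. vortex_density ((cmod C)\<^sup>2) (Suc m) (cmod y)) z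
    = ((LINT y|lborel. indicator {..<cmod z} (cmod y) * vortex_density ((cmod C)\<^sup>2) (Suc m) (cmod y)) / (cmod z)\<^sup>2) *\<^sub>R perp z"
    by (rule gauge_potential_radial[OF _ vortex_density_bounded[OF a] _ assms(2)]) (use hbi in auto)
  then show ?thesis
    by (simp only: cmod_soliton_power2[OF assms(1)] vortex_mass_in_ball[OF a] norm_ge_zero)
qed

lemma soliton_measurable:
  assumes "C \<noteq> 0"
  shows "soliton C (Suc m) \<in> borel_measurable borel"
  by (intro borel_measurable_continuous_onI continuous_at_imp_continuous_on ballI
      has_derivative_continuous[OF has_derivative_soliton[OF assms]])

lemma integrable_energy_density:
  assumes "a > 0"
  shows "integrable lborel (\<lambda>z::complex. energy_density a m \<beta> (cmod z))"
  unfolding energy_density_def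
  by (intro integrable_mult_right Bochner_Integration.integrable_add Bochner_Integration.integrable_diff
      integrable_vortex_moment assms) auto

lemma integral_energy_density:
  assumes "a > 0"
  shows "(LINT z::complex|lborel. energy_density a m \<beta> (cmod z)) = a * real (Suc m) / pi *
     (2 * (real m)\<^sup>2 * a\<^sup>2 * vortex_moment a (Suc m) (2 * m - 2)
      - 2 * real m * (2 + \<beta>) * a * vortex_moment a (Suc m) (4 * m)
      + ((real m + 2)\<^sup>2 + (real m - \<beta>)\<^sup>2) * vortex_moment a (Suc m) (6 * m + 2))"
proof -
  have i: "integrable lborel (\<lambda>z::complex. cmod z ^ p / (cmod z ^ (2 * Suc m) + a) ^ 4)"
    if "p + 4 \<le> 8 * Suc m" for p
    by (rule integrable_vortex_moment[OF assms that])
  have "has_bochner_integral lborel (\<lambda>z::complex. energy_density a m \<beta> (cmod z)) (a * real (Suc m) / pi *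
     (2 * (real m)\<^sup>2 * a\<^sup>2 * vortex_moment a (Suc m) (2 * m - 2)
      - 2 * real m * (2 + \<beta>) * a * vortex_moment a (Suc m) (4 * m)
      + ((real m + 2)\<^sup>2 + (real m - \<beta>)\<^sup>2) * vortex_moment a (Suc m) (6 * m + 2)))"
    unfolding energy_density_def vortex_moment_def
    by (intro has_bochner_integral_mult_right has_bochner_integral_add has_bochner_integral_diff
        has_bochner_integral_integrable i) auto
  then show ?thesis by (rule has_bochner_integral_integral_eq)
qed

text \<open>At \<beta> = 0 the gradient identity has no potential term, so each partial derivative
  squared is at most the integrable energy density.\<close>

lemma soliton_deriv_L2:
  assumes C: "C \<noteq> 0" and e: "e \<in> Basis"
  shows "(\<lambda>z. soliton_deriv C m z e) \<in> L2"
proof -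
  have m: "(\<lambda>z. soliton_deriv C m z e) \<in> borel_measurable borel"
    by (intro borel_measurable_continuous_onI continuous_soliton_deriv C)
  have "integrable lborel (\<lambda>z. (cmod (soliton_deriv C m z e))\<^sup>2)"
  proof (rule Bochner_Integration.integrable_bound)
    show "integrable lborel (\<lambda>z. energy_density ((cmod C)\<^sup>2) m 0 (cmod z))"
      by (rule integrable_energy_density) (use C in simp)
    show "AE z in lborel. norm ((cmod (soliton_deriv C m z e))\<^sup>2) \<le> norm (energy_density ((cmod C)\<^sup>2) m 0 (cmod z))"
      using AE_lborel_singleton[of 0]
    proof eventually_elim
      case (elim z)
      have "(cmod (soliton_deriv C m z 1))\<^sup>2 + (cmod (soliton_deriv C m z \<i>))\<^sup>2 = energy_density ((cmod C)\<^sup>2) m 0 (cmod z)"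
        using soliton_covariant_gradient_norm[OF C elim, of m 0] by simp
      moreover have "e = 1 \<or> e = \<i>" using e by (simp add: Basis_complex_def)
      ultimately have "(cmod (soliton_deriv C m z e))\<^sup>2 \<le> energy_density ((cmod C)\<^sup>2) m 0 (cmod z)"
        using zero_le_power2[of "cmod (soliton_deriv C m z 1)"] zero_le_power2[of "cmod (soliton_deriv C m z \<i>)"]
        by (elim disjE; hypsubst; linarith)
      then show ?case by simp
    qed
  qed (use m in measurable)
  then show ?thesis using m by (simp add: L2_def)
qed

lemma integral_soliton_power2:
  assumes "C \<noteq> 0"
  shows "has_bochner_integral lborel (\<lambda>z. (cmod (soliton C (Suc m) z))\<^sup>2) 1"
  using has_bochner_integral_vortex_density[of "(cmod C)\<^sup>2" "Suc m"] assms
  by (simp add: cmod_soliton_power2)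

lemma soliton_H1:
  assumes "C \<noteq> 0"
  shows "soliton C (Suc m) \<in> H1"
  unfolding H1_def
proof safe
  show "soliton C (Suc m) \<in> L2"
    using integral_soliton_power2[OF assms, of m] soliton_measurable[OF assms, of m] by (simp add: L2_def has_bochner_integral_iff)
  show "\<exists>v\<in>L2. is_weak_partial e (soliton C (Suc m)) v" if "e \<in> Basis" for e
    using is_weak_partial_if_C1[OF has_derivative_soliton continuous_soliton_deriv that] soliton_deriv_L2 assms that
    by blast
qed

lemma quartic_soliton:
  assumes "C \<noteq> 0"
  shows "quartic (soliton C (Suc m)) = ((cmod C)\<^sup>2 * real (Suc m) / pi)\<^sup>2 * vortex_moment ((cmod C)\<^sup>2) (Suc m) (4 * m)"
proof -
  have "cmod (soliton C (Suc m) z) ^ 4 = ((cmod C)\<^sup>2 * real (Suc m) / pi)\<^sup>2 *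
      (cmod z ^ (4 * m) / (cmod z ^ (2 * Suc m) + (cmod C)\<^sup>2) ^ 4)" for z
  proof -
    have "cmod (soliton C (Suc m) z) ^ 4 = ((cmod (soliton C (Suc m) z))\<^sup>2)\<^sup>2" by simp
    then show ?thesis
      unfolding cmod_soliton_power2[OF assms] vortex_density_def power_mult_distrib power_divide
      by (simp flip: power_mult)
  qed
  then show ?thesis unfolding quartic_def vortex_moment_def by (simp only: integral_mult_right_zero)
qed

lemma energy_soliton:
  assumes C: "C \<noteq> 0"
  shows "energy \<beta> (soliton C (Suc m)) = (LINT z|lborel. energy_density ((cmod C)\<^sup>2) m \<beta> (cmod z))"
  unfolding energy_def
proof (rule integral_cong_AE)
  let ?u = "soliton C (Suc m)"
  let ?A = "gauge_potential (\<lambda>y. (cmod (?u y))\<^sup>2)"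
  note [measurable] = soliton_measurable[OF C, of m]
  note wp = weak_partial_AE_if_C1[OF has_derivative_soliton continuous_soliton_deriv _ soliton_deriv_L2, OF C C _ C, of _ m]
  have B: "1 \<in> (Basis :: complex set)" "\<i> \<in> Basis" by (simp_all add: Basis_complex_def)
  have norm_eq: "(norm (covariant_gradient \<beta> ?u z))\<^sup>2
      = (cmod (weak_partial 1 ?u z + \<i> * of_real (\<beta> * Re (?A z)) * ?u z))\<^sup>2
      + (cmod (weak_partial \<i> ?u z + \<i> * of_real (\<beta> * Im (?A z)) * ?u z))\<^sup>2" for z
    by (simp add: covariant_gradient_def Let_def norm_Pair)
  \<comment> \<open>Serves measurability: the potential has an explicit formula off the origin, and
    its value at the origin is just some constant.\<close>
  have A_eq: "?A = (\<lambda>z. if z = 0 then ?A 0 else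
      (cmod z ^ (2 * Suc m) / (cmod z ^ (2 * Suc m) + (cmod C)\<^sup>2) / (cmod z)\<^sup>2) *\<^sub>R (\<i> * z))"
  proof (rule ext)
    fix z
    show "?A z = (if z = 0 then ?A 0 else
      (cmod z ^ (2 * Suc m) / (cmod z ^ (2 * Suc m) + (cmod C)\<^sup>2) / (cmod z)\<^sup>2) *\<^sub>R (\<i> * z))"
    proof (cases "z = 0")
      case False
      then show ?thesis
        using gauge_potential_soliton[OF C False, of m] by (simp only: perp_eq if_False)
    qed simp
  qed
  have A[measurable]: "?A \<in> borel_measurable borel"
    by (subst A_eq) measurable
  have [measurable]: "weak_partial 1 ?u \<in> borel_measurable borel" "weak_partial \<i> ?u \<in> borel_measurable borel"
    using wp(1)[OF B(1) B(1)] wp(1)[OF B(2) B(2)] by (simp_all add: L2_def)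
  show "(\<lambda>z. (norm (covariant_gradient \<beta> ?u z))\<^sup>2) \<in> borel_measurable lborel"
    unfolding norm_eq by measurable
  show "(\<lambda>z. energy_density ((cmod C)\<^sup>2) m \<beta> (cmod z)) \<in> borel_measurable lborel"
    unfolding energy_density_def by measurable
  show "AE z in lborel. (norm (covariant_gradient \<beta> ?u z))\<^sup>2 = energy_density ((cmod C)\<^sup>2) m \<beta> (cmod z)"
    using wp(2)[OF B(1) B(1)] wp(2)[OF B(2) B(2)] AE_lborel_singleton[of 0]
  proof eventually_elim
    case (elim z)
    then show ?case
      unfolding norm_eq elim(1,2) gauge_potential_soliton[OF C elim(3)]
        soliton_covariant_gradient_norm[OF C elim(3), symmetric]
      by (simp add: perp_def)
  qed
qed

text \<open>The recurrence expresses every moment in the energy through \<open>J (4 * m)\<close>,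
  the moment of the quartic integral, so it cancels in the quotient and only algebra in
  \<open>m\<close> and \<beta> remains.\<close>

lemma energy_gamma_soliton:
  assumes C: "C \<noteq> 0"
  shows "quartic (soliton C (Suc m)) > 0"
    and "energy_gamma \<beta> (2 * pi * \<beta>) (soliton C (Suc m)) / quartic (soliton C (Suc m))
      = pi * (2 * real (Suc m) - 1) / (real (Suc m) * (real (Suc m) + 1)) * (\<beta> - 2 * real (Suc m))\<^sup>2"
proof -
  define a where "a = (cmod C)\<^sup>2"
  have a: "a > 0" using C by (simp add: a_def)
  define N where "N = a * real (Suc m) / pi"
  have N: "N > 0" using a by (simp add: N_def)
  define J where "J = vortex_moment a (Suc m)"
  have J: "J (4 * m) > 0" unfolding J_def by (rule vortex_moment_pos) (use a in auto)
  have Q: "quartic (soliton C (Suc m)) = N\<^sup>2 * J (4 * m)"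
    by (simp only: quartic_soliton[OF C] N_def J_def a_def)
  then show "quartic (soliton C (Suc m)) > 0" using N J by simp
  \<comment> \<open>The recurrence with k = 2 m, multiplied by \<open>m\<close>. This factor also
    makes the claim trivial for \<open>m = 0\<close>, where k = 2 m would be too small.\<close>
  have rec0: "2 * (real m)\<^sup>2 * a * J (2 * m - 2) = real m * (4 * real m + 6) * J (4 * m)"
  proof (cases m)
    case (Suc j)
    have "real (2 * m) * a * J (2 * m - 2) = (6 * real (Suc m) - real (2 * m)) * J (2 * m - 2 + 2 * Suc m)"
      unfolding J_def by (rule vortex_moment_recurrence[OF a]) (use Suc in auto)
    also have "2 * m - 2 + 2 * Suc m = 4 * m" using Suc by simp
    also have "6 * real (Suc m) - real (2 * m) = 4 * real m + 6" by simp
    finally have "real m * (real (2 * m) * a * J (2 * m - 2)) = real m * ((4 * real m + 6) * J (4 * m))"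
      by simp
    then show ?thesis by (simp add: power2_eq_square mult_ac)
  qed simp
  \<comment> \<open>The recurrence with k = 4 m + 2, divided by 2.\<close>
  have rec1: "(2 * real m + 1) * a * J (4 * m) = (real m + 2) * J (6 * m + 2)"
  proof -
    have "real (4 * m + 2) * a * J (4 * m + 2 - 2) = (6 * real (Suc m) - real (4 * m + 2)) * J (4 * m + 2 - 2 + 2 * Suc m)"
      unfolding J_def by (rule vortex_moment_recurrence[OF a]) auto
    also have "4 * m + 2 - 2 + 2 * Suc m = 6 * m + 2" by simp
    finally show ?thesis by (simp add: algebra_simps)
  qed
  have J6: "J (6 * m + 2) = (2 * real m + 1) / (real m + 2) * (a * J (4 * m))"
    using rec1 by (simp add: field_simps)
  have "energy \<beta> (soliton C (Suc m)) = N * (2 * (real m)\<^sup>2 * a\<^sup>2 * J (2 * m - 2)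
      - 2 * real m * (2 + \<beta>) * a * J (4 * m) + ((real m + 2)\<^sup>2 + (real m - \<beta>)\<^sup>2) * J (6 * m + 2))"
    unfolding energy_soliton[OF C] a_def[symmetric] integral_energy_density[OF a] N_def J_def ..
  also have "2 * (real m)\<^sup>2 * a\<^sup>2 * J (2 * m - 2) = a * (2 * (real m)\<^sup>2 * a * J (2 * m - 2))"
    by (simp add: power2_eq_square)
  finally have E: "energy \<beta> (soliton C (Suc m)) = N * (a * J (4 * m)) * (real m * (4 * real m + 6)
      - 2 * real m * (2 + \<beta>) + ((real m + 2)\<^sup>2 + (real m - \<beta>)\<^sup>2) * ((2 * real m + 1) / (real m + 2)))"
    unfolding rec0 J6 by (simp add: algebra_simps add_divide_distrib)
  \<comment> \<open>Since pi N = a (m + 1), the interaction term is expressed in the same unit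
    \<open>N * (a * J (4 * m))\<close> as the energy.\<close>
  have "2 * pi * \<beta> * (N\<^sup>2 * J (4 * m)) = N * (a * J (4 * m)) * (2 * (real m + 1) * \<beta>)"
  proof -
    have "pi * N = a * (real m + 1)" by (simp add: N_def)
    then have "2 * \<beta> * N * J (4 * m) * (pi * N) = 2 * \<beta> * N * J (4 * m) * (a * (real m + 1))"
      by (rule arg_cong)
    then show ?thesis by (simp only: power2_eq_square mult_ac)
  qed
  then have E\<gamma>: "energy \<beta> (soliton C (Suc m)) - 2 * pi * \<beta> * (N\<^sup>2 * J (4 * m))
      = N * (a * J (4 * m)) * (real m * (4 * real m + 6) - 2 * real m * (2 + \<beta>)
        + ((real m + 2)\<^sup>2 + (real m - \<beta>)\<^sup>2) * ((2 * real m + 1) / (real m + 2)) - 2 * (real m + 1) * \<beta>)"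
    unfolding E by (simp only: right_diff_distrib)
  have "energy_gamma \<beta> (2 * pi * \<beta>) (soliton C (Suc m)) = N * (a * J (4 * m)) * (real m * (4 * real m + 6)
      - 2 * real m * (2 + \<beta>) - 2 * (real m + 1) * \<beta> + ((real m + 2)\<^sup>2 + (real m - \<beta>)\<^sup>2) * ((2 * real m + 1) / (real m + 2)))"
    unfolding energy_gamma_def Q E\<gamma> by (simp only: diff_conv_add_uminus add_ac)
  also have "real m * (4 * real m + 6) - 2 * real m * (2 + \<beta>) - 2 * (real m + 1) * \<beta>
        + ((real m + 2)\<^sup>2 + (real m - \<beta>)\<^sup>2) * ((2 * real m + 1) / (real m + 2))
      = (2 * real m + 1) / (real m + 2) * (\<beta> - 2 * (real m + 1))\<^sup>2"
  proof -
    have nz: "real m + 2 \<noteq> 0" by linarith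
    \<comment> \<open>This is where the coupling matters: with it these terms factor as 2 (2 m + 1)
      (m - \<beta>), which is the cross term completing (m + 2)^2 + (m - \<beta>)^2 to the square of
      2 m + 2 - \<beta>.\<close>
    have "real m * (4 * real m + 6) - 2 * real m * (2 + \<beta>) - 2 * (real m + 1) * \<beta>
      = (2 * real m + 1) / (real m + 2) * (2 * (real m + 2) * (real m - \<beta>))"
      using nz by (simp add: field_simps)
    then have "real m * (4 * real m + 6) - 2 * real m * (2 + \<beta>) - 2 * (real m + 1) * \<beta>
        + ((real m + 2)\<^sup>2 + (real m - \<beta>)\<^sup>2) * ((2 * real m + 1) / (real m + 2))
      = (2 * real m + 1) / (real m + 2) * (2 * (real m + 2) * (real m - \<beta>) + ((real m + 2)\<^sup>2 + (real m - \<beta>)\<^sup>2))"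
      by (simp only: distrib_left mult.commute)
    also have "2 * (real m + 2) * (real m - \<beta>) + ((real m + 2)\<^sup>2 + (real m - \<beta>)\<^sup>2) = (\<beta> - 2 * (real m + 1))\<^sup>2"
      by (simp add: power2_eq_square algebra_simps)
    finally show ?thesis .
  qed
  finally have "energy_gamma \<beta> (2 * pi * \<beta>) (soliton C (Suc m)) / quartic (soliton C (Suc m))
      = a / N * ((2 * real m + 1) / (real m + 2) * (\<beta> - 2 * (real m + 1))\<^sup>2)"
    unfolding Q using N J by (simp add: power2_eq_square)
  also have "a / N = pi / real (Suc m)" using a by (simp add: N_def)
  finally show "energy_gamma \<beta> (2 * pi * \<beta>) (soliton C (Suc m)) / quartic (soliton C (Suc m))
      = pi * (2 * real (Suc m) - 1) / (real (Suc m) * (real (Suc m) + 1)) * (\<beta> - 2 * real (Suc m))\<^sup>2"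
    by (simp add: add.commute)
qed

text \<open>The infimum over reals needs a lower bound. Zero is one: both integrands are
  nonnegative, and a divergent integral or a zero denominator also yields 0.\<close>

lemma gamma_star_le:
  assumes "u \<in> H1" "(LINT x|lborel. (cmod (u x))\<^sup>2) = 1"
  shows "gamma_star \<beta> \<le> energy \<beta> u / quartic u"
  unfolding gamma_star_def
proof (rule cInf_lower)
  show "bdd_below {energy \<beta> u / quartic u | u. u \<in> H1 \<and> (LINT x|lborel. (cmod (u x))\<^sup>2) = 1}"
    by (rule bdd_belowI[of _ 0]) (auto simp: energy_def quartic_def)
qed (use assms in blast)

theorem proposition3p34:
  fixes C :: complex
  assumes "C \<noteq> 0"
  shows "(\<forall>n::nat. n \<ge> 1 \<longrightarrow>
            soliton C n \<in> H1 \<and> (LINT z|lborel. (cmod (soliton C n z))\<^sup>2) = 1)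
       \<and> (\<forall>n::nat. \<forall>\<beta>::real. n \<ge> 1 \<longrightarrow> \<beta> \<ge> 0 \<longrightarrow>
            energy_gamma \<beta> (2 * pi * \<beta>) (soliton C n) / quartic (soliton C n)
              = pi * (2 * real n - 1) / (real n * (real n + 1)) * (\<beta> - 2 * real n)\<^sup>2)
       \<and> (\<forall>\<beta>::real. \<beta> \<ge> 0 \<longrightarrow> gamma_star \<beta> \<le> 2 * pi + pi / 2 * \<beta>\<^sup>2)"
proof (intro conjI allI impI)
  fix n :: nat assume "n \<ge> 1"
  then obtain m where n: "n = Suc m" by (cases n) auto
  show "soliton C n \<in> H1" "(LINT z|lborel. (cmod (soliton C n z))\<^sup>2) = 1"
    unfolding n using soliton_H1[OF assms] integral_soliton_power2[OF assms]
    by (auto simp: has_bochner_integral_iff)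
next
  fix n :: nat and \<beta> :: real assume "n \<ge> 1"
  then obtain m where n: "n = Suc m" by (cases n) auto
  show "energy_gamma \<beta> (2 * pi * \<beta>) (soliton C n) / quartic (soliton C n)
      = pi * (2 * real n - 1) / (real n * (real n + 1)) * (\<beta> - 2 * real n)\<^sup>2"
    unfolding n by (rule energy_gamma_soliton(2)[OF assms])
next
  fix \<beta> :: real
  let ?u = "soliton C (Suc 0)"
  have "gamma_star \<beta> \<le> energy \<beta> ?u / quartic ?u"
    using soliton_H1[OF assms] integral_soliton_power2[OF assms]
    by (intro gamma_star_le) (auto simp: has_bochner_integral_iff)
  also have "\<dots> = energy_gamma \<beta> (2 * pi * \<beta>) ?u / quartic ?u + 2 * pi * \<beta>"
    using energy_gamma_soliton(1)[OF assms, of 0] by (simp add: energy_gamma_def diff_divide_distrib)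
  \<comment> \<open>For n = 1 the quotient is (pi / 2) (\<beta> - 2)^2, whose linear term - 2 pi
    \<beta> cancels the added coupling.\<close>
  also have "\<dots> = 2 * pi + pi / 2 * \<beta>\<^sup>2"
    unfolding energy_gamma_soliton(2)[OF assms] by (simp add: power2_eq_square algebra_simps)
  finally show "gamma_star \<beta> \<le> 2 * pi + pi / 2 * \<beta>\<^sup>2" .
qed

end
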